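(* Let $m\ge 1$, $\varepsilon>0$ and $D\ge 0$. There exists a positive constant $A=A(\varepsilon,m,D)$, depending only on $\varepsilon$, $m$ and $D$, such that the following holds. Let $X\subset\mathbb{R}^m$ be compact with $\mathrm{diam}(X)\le D$, equipped with the Euclidean distance $d_X(x,x')=\|x-x'\|$; let $c,\Lambda>0$, $\lambda\ge 0$, and let $\alpha,\beta\in\mathcal{P}_f^{c,\Lambda}(X)$. Then $$\sup_{x,x'\in X}\left|d^{(\varepsilon,\lambda)}_{\alpha,d_X}(x,x')-d^{(\varepsilon,\lambda)}_{\beta,d_X}(x,x')\right|\le 2\sqrt{m\,\lambda\,\Psi^{c,A}_{\Lambda,D,\varepsilon}\big(d_{\mathrm{W},\infty}(\alpha,\beta)\big)},$$ where $\Psi^{c,A}_{\Lambda,D,\varepsilon}:[0,\infty)\to[0,\infty)$ (given by an explicit formula in the context) is an increasing function with $\Psi^{c,A}_{\Lambda,D,\varepsilon}(0)=0$.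
   Context: $\mathcal{P}_f(X)$ is the set of Borel probability measures on $X$ with full support. For $x\in X$, $r>0$: $B_r^{d_X}(x)=\{x'\in X: d_X(x,x')\le r\}$. $\mathcal{L}_m$ is Lebesgue measure on $\mathbb{R}^m$, and $\nu_m$ is the volume of the unit ball of $\mathbb{R}^m$. $\mathcal{P}_f^{c,\Lambda}(X)$ is the set of all $\alpha\in\mathcal{P}_f(X)$ such that (i) $\alpha(B^{d_X}_{r_1}(x))/\alpha(B^{d_X}_{r_2}(x))\le (r_1/r_2)^\Lambda$ for all $x\in X$ and $r_1\ge r_2>0$, and (ii) $\alpha(S)\le c\cdot\mathcal{L}_m(S)$ for every measurable $S\subset\mathbb{R}^m$ (with $\alpha$ viewed as a measure on $\mathbb{R}^m$). For $\alpha\in\mathcal{P}_f(X)$ and $x\in X$, $m^{(\varepsilon)}_{\alpha,d_X}(x)=\alpha|_{B_\varepsilon^{d_X}(x)}/\alpha(B_\varepsilon^{d_X}(x))$ is the renormalized restriction of $\alpha$ to the ball; $\mu^{(\varepsilon)}_{\alpha,d_X}(x)$ and $\Sigma^{(\varepsilon)}_{\alpha,d_X}(x)$ are the mean and the covariance matrix of this probability measure. For positive semi-definite matrices, $d_{\mathrm{cov}}(\Sigma_1,\Sigma_2)=\sqrt{\mathrm{tr}\big(\Sigma_1+\Sigma_2-2(\Sigma_1^{1/2}\Sigma_2\Sigma_1^{1/2})^{1/2}\big)}$. GT distance: $d^{(\varepsilon,\lambda)}_{\alpha,d_X}(x,x')=\left(\|x-x'\|^2+\lambda\, d_{\mathrm{cov}}^2\big(\Sigma^{(\varepsilon)}_{\alpha,d_X}(x),\Sigma^{(\varepsilon)}_{\alpha,d_X}(x')\big)\right)^{1/2}$.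 $d_{\mathrm{W},\infty}(\alpha,\beta)$ is the $\ell^\infty$-Wasserstein distance: the infimum over couplings $\pi$ of $\alpha,\beta$ of $\sup\{d_X(x,x'):(x,x')\in\mathrm{supp}(\pi)\}$. Formula for $\Psi^{c,A}_{\Lambda,D,\varepsilon}$: put $\psi_{\Lambda,D}(\varepsilon)=\min(1,(\varepsilon/D)^\Lambda)$ (equal to $1$ if $D=0$) and, for $t\ge0$, $\Phi_{\Lambda,\varepsilon}(t)=\big((1+t/\varepsilon)^\Lambda-1\big)+t$, $\Psi_{\Lambda,D,\varepsilon}(t)=\frac{t}{\psi_{\Lambda,D}(\varepsilon)}+\big[(1+t/\varepsilon)^\Lambda-1\big]$, $\Phi^{c,A}_{\Lambda,D,\varepsilon}(t)=\frac{\varepsilon^m\nu_m\,c\,A}{\psi_{\Lambda,D}(\varepsilon)}\,t+\frac{\varepsilon^2}{\psi_{\Lambda,D}(\varepsilon)^2}\,\Phi_{\Lambda,\varepsilon}(\sqrt t)$, $\Psi^{c,A}_{\Lambda,D,\varepsilon}(t)=\Phi^{c,A}_{\Lambda,D,\varepsilon}(t)+2\varepsilon(1+2\varepsilon)\,\Psi_{\Lambda,D,\varepsilon}(\sqrt t)$. *)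

theory Defs
  imports "HOL-Analysis.Analysis" "HOL-Probability.Probability_Measure"
begin

section \<open>Probability measures on a subset of a topological space\<close>

text \<open>A Borel measure on \<open>X\<close> lives on the subspace \<open>X\<close> itself, i.e. its \<sigma>-algebra is
  \<^term>\<open>sets (restrict_space borel X)\<close>, so that \<open>space \<alpha> = X\<close>.\<close>

definition measure_support :: "'a::topological_space measure \<Rightarrow> 'a set" where
  "measure_support M =
     {x \<in> space M. \<forall>U. open U \<and> x \<in> U \<longrightarrow> emeasure M (U \<inter> space M) > 0}"

definition full_prob_measures :: "'a::topological_space set \<Rightarrow> 'a measure set" where
  "full_prob_measures X =
     {\<alpha>. prob_space \<alpha> \<and> sets \<alpha> = sets (restrict_space borel X) \<and> measure_support \<alpha> = X}"

definition metric_ball :: "'a::metric_space set \<Rightarrow> 'a \<Rightarrow> real \<Rightarrow> 'a set" where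
  "metric_ball X x r = {x' \<in> X. dist x x' \<le> r}"

text \<open>The value at \<open>S\<close> of \<open>\<alpha>\<close>, viewed as a measure on the ambient Euclidean space,
  is \<open>\<alpha> (S \<inter> X)\<close>.\<close>

definition regular_prob_measures ::
    "real \<Rightarrow> real \<Rightarrow> 'a::euclidean_space set \<Rightarrow> 'a measure set" where
  "regular_prob_measures c \<Lambda> X =
     {\<alpha> \<in> full_prob_measures X.
        (\<forall>x\<in>X. \<forall>r1 r2. r1 \<ge> r2 \<and> r2 > 0 \<longrightarrow>
           measure \<alpha> (metric_ball X x r1) / measure \<alpha> (metric_ball X x r2)
             \<le> (r1 / r2) powr \<Lambda>) \<and>
        (\<forall>S\<in>sets borel. emeasure \<alpha> (S \<inter> X) \<le> ennreal c * emeasure lborel S)}"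


section \<open>Local means and covariance matrices\<close>

definition local_measure :: "real \<Rightarrow> 'a::metric_space measure \<Rightarrow> 'a \<Rightarrow> 'a measure" where
  "local_measure \<epsilon> \<alpha> x = uniform_measure \<alpha> (metric_ball (space \<alpha>) x \<epsilon>)"

definition mean_vec :: "(real^'n) measure \<Rightarrow> real^'n" where
  "mean_vec M = (LINT y|M. y)"

definition cov_matrix :: "(real^'n) measure \<Rightarrow> real^'n^'n" where
  "cov_matrix M =
     (\<chi> i j. LINT y|M. (y $ i - mean_vec M $ i) * (y $ j - mean_vec M $ j))"

definition local_cov :: "real \<Rightarrow> (real^'n) measure \<Rightarrow> real^'n \<Rightarrow> real^'n^'n" where
  "local_cov \<epsilon> \<alpha> x = cov_matrix (local_measure \<epsilon> \<alpha> x)"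


section \<open>The distance between covariance matrices\<close>

definition pos_semidef :: "real^'n^'n \<Rightarrow> bool" where
  "pos_semidef A \<longleftrightarrow> transpose A = A \<and> (\<forall>v. v \<bullet> (A *v v) \<ge> 0)"

text \<open>The positive semi-definite square root; it exists and is unique when the argument is
  positive semi-definite, and is unspecified otherwise.\<close>

definition matrix_sqrt :: "real^'n^'n \<Rightarrow> real^'n^'n" where
  "matrix_sqrt A = (THE B. pos_semidef B \<and> B ** B = A)"

definition d_cov :: "real^'n^'n \<Rightarrow> real^'n^'n \<Rightarrow> real" where
  "d_cov S1 S2 =
     sqrt (trace (S1 + S2 - 2 *\<^sub>R matrix_sqrt (matrix_sqrt S1 ** S2 ** matrix_sqrt S1)))"

definition GT_dist ::
    "real \<Rightarrow> real \<Rightarrow> (real^'n) measure \<Rightarrow> real^'n \<Rightarrow> real^'n \<Rightarrow> real" where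
  "GT_dist \<epsilon> lam \<alpha> x x' =
     sqrt ((norm (x - x'))\<^sup>2 + lam * (d_cov (local_cov \<epsilon> \<alpha> x) (local_cov \<epsilon> \<alpha> x'))\<^sup>2)"


section \<open>The \<open>\<infinity>\<close>-Wasserstein distance\<close>

definition couplings :: "'a measure \<Rightarrow> 'b measure \<Rightarrow> ('a \<times> 'b) measure set" where
  "couplings \<alpha> \<beta> =
     {\<pi>. prob_space \<pi> \<and> sets \<pi> = sets (\<alpha> \<Otimes>\<^sub>M \<beta>) \<and> distr \<pi> \<alpha> fst = \<alpha> \<and> distr \<pi> \<beta> snd = \<beta>}"

text \<open>For Borel probability measures on a common compact subset of Euclidean space, the infimum
  is over a nonempty set of nonnegative reals and each supremum is over a nonempty bounded set,
  so the real-valued \<open>INF\<close> and \<open>SUP\<close> are the genuine ones.\<close>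

definition wasserstein_inf :: "'a::metric_space measure \<Rightarrow> 'a measure \<Rightarrow> real" where
  "wasserstein_inf \<alpha> \<beta> =
     (INF \<pi>\<in>couplings \<alpha> \<beta>. SUP p\<in>measure_support \<pi>. dist (fst p) (snd p))"


section \<open>The control functions\<close>

definition psi_vol :: "real \<Rightarrow> real \<Rightarrow> real \<Rightarrow> real" where
  "psi_vol \<Lambda> D \<epsilon> = (if D = 0 then 1 else min 1 ((\<epsilon> / D) powr \<Lambda>))"

definition Phi_base :: "real \<Rightarrow> real \<Rightarrow> real \<Rightarrow> real" where
  "Phi_base \<Lambda> \<epsilon> t = ((1 + t / \<epsilon>) powr \<Lambda> - 1) + t"

definition Psi_base :: "real \<Rightarrow> real \<Rightarrow> real \<Rightarrow> real \<Rightarrow> real" where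
  "Psi_base \<Lambda> D \<epsilon> t = t / psi_vol \<Lambda> D \<epsilon> + ((1 + t / \<epsilon>) powr \<Lambda> - 1)"

definition Phi_fun ::
    "nat \<Rightarrow> real \<Rightarrow> real \<Rightarrow> real \<Rightarrow> real \<Rightarrow> real \<Rightarrow> real \<Rightarrow> real" where
  "Phi_fun m c A \<Lambda> D \<epsilon> t =
     (\<epsilon> ^ m * unit_ball_vol (real m) * c * A) / psi_vol \<Lambda> D \<epsilon> * t
     + \<epsilon>\<^sup>2 / (psi_vol \<Lambda> D \<epsilon>)\<^sup>2 * Phi_base \<Lambda> \<epsilon> (sqrt t)"

definition Psi_fun ::
    "nat \<Rightarrow> real \<Rightarrow> real \<Rightarrow> real \<Rightarrow> real \<Rightarrow> real \<Rightarrow> real \<Rightarrow> real" where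
  "Psi_fun m c A \<Lambda> D \<epsilon> t =
     Phi_fun m c A \<Lambda> D \<epsilon> t + 2 * \<epsilon> * (1 + 2 * \<epsilon>) * Psi_base \<Lambda> D \<epsilon> (sqrt t)"

end

theory Submission
  imports Defs
begin

text \<open>
  The quantity \<open>d_cov S T\<close> is the minimum of \<open>\<parallel>S\<^sup>1\<^sup>/\<^sup>2 - U T\<^sup>1\<^sup>/\<^sup>2\<parallel>\<close>
  over orthogonal \<open>U\<close> (Frobenius norm), hence a pseudometric, and it is at most \<open>sqrt (m \<kappa>)\<close>
  if the quadratic forms of \<open>S\<close> and \<open>T\<close> differ by at most \<open>\<kappa>\<close> on the unit sphere. So it
  suffices to compare the variances of \<open>v \<bullet> y\<close> under the two local measures at the same point.
  A coupling that moves mass by at most \<open>t\<close> compares the restrictions to the \<open>\<epsilon>\<close>-ball up to the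
  mass of the shell between radii \<open>\<epsilon>\<close> and \<open>\<epsilon> + t\<close>, which the doubling condition controls; the
  variances differ by at most \<open>4 \<epsilon> t + 9 \<epsilon>\<^sup>2 \<theta>(t)\<close> with \<open>\<theta>(t) = (1 + t / \<epsilon>)\<^sup>\<Lambda> - 1\<close>.
  For small \<open>t\<close> this is absorbed by the terms in \<open>sqrt t\<close> of \<open>\<Psi>\<close>. For larger \<open>t\<close> the trivial
  bound \<open>\<epsilon>\<^sup>2\<close> is at most \<open>A t\<close> for a suitable \<open>A\<close>, and \<open>A t \<le> \<Psi>(t)\<close> because the density bound
  makes \<open>c\<close> times the volume of the \<open>\<epsilon>\<close>-ball at least \<open>psi_vol\<close>.
\<close>

section \<open>Square roots of positive semidefinite matrices\<close>

lemma symmetric_dot: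
  fixes A :: "real^'n^'n"
  assumes "transpose A = A"
  shows "v \<bullet> (A *v w) = (A *v v) \<bullet> w"
  by (metis assms dot_lmul_matrix vector_transpose_matrix)

lemma symmetric_nth:
  fixes A :: "'a^'n^'n"
  assumes "transpose A = A"
  shows "A $ i $ j = A $ j $ i"
  using assms unfolding transpose_def vec_eq_iff by simp

text \<open>Otherwise a small step from \<open>v\<close> against \<open>w = A *v v\<close> makes the
  quadratic form negative, since the form is 0 at \<open>v\<close> and changes by
  \<open>2 * t * (w \<bullet> w)\<close> to first order in \<open>t\<close>.\<close>

lemma pos_semidef_null:
  fixes A :: "real^'n^'n"
  assumes A: "pos_semidef A" and v: "v \<bullet> (A *v v) = 0"
  shows "A *v v = 0"
proof (rule ccontr)
  define w where "w = A *v v"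
  assume "A *v v \<noteq> 0"
  then have N: "w \<bullet> w > 0" by (simp add: w_def)
  define q where "q = w \<bullet> (A *v w)"
  have q: "q \<ge> 0" using A by (simp add: pos_semidef_def q_def)
  have sym: "transpose A = A" using A by (simp add: pos_semidef_def)
  \<comment> \<open>The denominator \<open>q + 1\<close> keeps \<open>t * q\<close> at most
    \<open>w \<bullet> w\<close> in absolute value and is positive even if
    \<open>q = 0\<close>.\<close>
  define t where "t = - (w \<bullet> w) / (q + 1)"
  have "0 \<le> (v + t *\<^sub>R w) \<bullet> (A *v (v + t *\<^sub>R w))"
    using A by (simp add: pos_semidef_def)
  also have "\<dots> = v \<bullet> (A *v v) + t * (v \<bullet> (A *v w)) + t * (w \<bullet> (A *v v)) + t * t * (w \<bullet> (A *v w))"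
    by (simp add: matrix_vector_right_distrib matrix_vector_mult_scaleR inner_add_left inner_add_right algebra_simps)
  also have "\<dots> = 2 * t * (w \<bullet> w) + t * t * q"
    using v symmetric_dot[OF sym, of v w] by (simp add: w_def[symmetric] q_def)
  also have "\<dots> = t * (2 * (w \<bullet> w) + t * q)" by (simp add: algebra_simps)
  also have "\<dots> < 0"
  proof (rule mult_neg_pos)
    show "t < 0" using N q by (simp add: t_def)
    have "(w \<bullet> w) * q / (q + 1) \<le> w \<bullet> w" using q N by (simp add: divide_simps)
    moreover have "t * q = - ((w \<bullet> w) * q / (q + 1))" by (simp add: t_def)
    ultimately show "0 < 2 * (w \<bullet> w) + t * q" using N by linarith
  qed
  finally show False by simp
qed

text \<open>Compactness gives a maximiser \<open>v\<close> of \<open>norm (A *v v)\<close> on the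
  sphere. It is an eigenvector of \<open>A ** A\<close> for the square of the maximum
  \<open>\<mu>\<close>, so either \<open>v\<close> is an eigenvector of \<open>A\<close> for
  \<open>-\<mu>\<close> or \<open>A *v v + \<mu> *\<^sub>R v\<close> is one for
  \<open>\<mu>\<close>. The last conclusion says that the operator norm is attained at this
  eigenvalue.\<close>

lemma symmetric_extremal_eigenvector:
  fixes A :: "real^'n^'n"
  assumes sym: "transpose A = A"
  obtains v \<mu> where "norm v = 1" "A *v v = \<mu> *\<^sub>R v" "\<And>w. norm (A *v w) \<le> \<bar>\<mu>\<bar> * norm w"
proof -
  have "continuous_on (sphere 0 1) (\<lambda>v. norm (A *v v))"
    by (intro continuous_intros matrix_vector_mult_linear_continuous_on)
  moreover have "sphere (0::real^'n) 1 \<noteq> {}" by (auto simp: sphere_eq_empty)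
  ultimately obtain v where v: "norm v = 1" and max: "\<And>w. norm w = 1 \<Longrightarrow> norm (A *v w) \<le> norm (A *v v)"
    using continuous_attains_sup[of "sphere 0 1" "\<lambda>v. norm (A *v v)"] by auto
  define \<mu> where "\<mu> = norm (A *v v)"
  have bound: "norm (A *v w) \<le> \<mu> * norm w" for w
  proof (cases "w = 0")
    case False
    have "norm (A *v ((1 / norm w) *\<^sub>R w)) \<le> \<mu>"
      unfolding \<mu>_def using False by (intro max) simp
    then show ?thesis using False by (simp add: matrix_vector_mult_scaleR divide_simps)
  qed auto
  \<comment> \<open>\<open>B\<close> is positive semidefinite with null vector \<open>v\<close>, hence \<open>(A + \<mu>) (A - \<mu>) v = 0\<close>.\<close>
  define B where "B = \<mu>\<^sup>2 *\<^sub>R mat 1 - A ** A"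
  have Bv: "B *v w = \<mu>\<^sup>2 *\<^sub>R w - A *v (A *v w)" for w
    by (simp add: B_def matrix_vector_mult_diff_rdistrib matrix_vector_mul_assoc scaleR_matrix_vector_assoc[symmetric])
  have Bq: "w \<bullet> (B *v w) = (\<mu> * norm w)\<^sup>2 - (norm (A *v w))\<^sup>2" for w
    by (simp add: Bv inner_diff_right symmetric_dot[OF sym] power_mult_distrib power2_norm_eq_inner)
  have "pos_semidef B"
    unfolding pos_semidef_def
  proof
    have "transpose (A ** A) = A ** A" by (simp add: sym matrix_transpose_mul)
    then have "(A ** A) $ i $ j = (A ** A) $ j $ i" for i j
      by (rule symmetric_nth)
    then show "transpose B = B"
      by (simp add: B_def transpose_def vec_eq_iff mat_def)
    show "\<forall>w. 0 \<le> w \<bullet> (B *v w)"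
      using bound by (auto simp: Bq intro!: power_mono)
  qed
  moreover have "v \<bullet> (B *v v) = 0" by (simp add: Bq v \<mu>_def)
  ultimately have "B *v v = 0" by (rule pos_semidef_null)
  then have AA: "A *v (A *v v) = \<mu>\<^sup>2 *\<^sub>R v" by (simp add: Bv)
  have \<mu>: "\<mu> \<ge> 0" by (simp add: \<mu>_def)
  define w where "w = A *v v + \<mu> *\<^sub>R v"
  show ?thesis
  proof (cases "w = 0")
    case True
    then have "A *v v = (- \<mu>) *\<^sub>R v" by (simp add: w_def eq_neg_iff_add_eq_0)
    then show ?thesis using that[of v "-\<mu>"] v bound \<mu> by simp
  next
    case False
    have "A *v w = \<mu> *\<^sub>R w"
      by (simp add: w_def matrix_vector_right_distrib AA matrix_vector_mult_scaleR scaleR_add_right power2_eq_square)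
    then have "A *v ((1 / norm w) *\<^sub>R w) = \<mu> *\<^sub>R ((1 / norm w) *\<^sub>R w)"
      by (simp add: matrix_vector_mult_scaleR)
    then show ?thesis using that[of "(1 / norm w) *\<^sub>R w" \<mu>] False bound \<mu> by simp
  qed
qed

lemma norm_sq_matrix_columns:
  fixes A :: "real^'n^'m"
  shows "(norm A)\<^sup>2 = (\<Sum>j\<in>UNIV. (norm (column j A))\<^sup>2)"
proof -
  have "(norm A)\<^sup>2 = (\<Sum>i\<in>UNIV. \<Sum>j\<in>UNIV. (A$i$j)\<^sup>2)"
    unfolding power2_norm_eq_inner by (simp add: inner_vec_def power2_eq_square)
  also have "\<dots> = (\<Sum>j\<in>UNIV. \<Sum>i\<in>UNIV. (A$i$j)\<^sup>2)" by (rule sum.swap)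
  finally show ?thesis
    unfolding power2_norm_eq_inner by (simp add: inner_vec_def power2_eq_square column_def)
qed

text \<open>Hoelder continuity of the square root with exponent 1/2. For an extremal eigenpair of
  \<open>P - Q\<close>, the form of \<open>P ** P - Q ** Q\<close> at \<open>v\<close> is
  \<open>\<mu> * (p + q)\<close> with \<open>\<mu> = p - q\<close> and \<open>p, q \<ge> 0\<close>.
  Hence the square of \<open>\<mu>\<close> is at most \<open>\<kappa>\<close>, and
  \<open>\<bar>\<mu>\<bar>\<close> bounds the norm of every column of \<open>P - Q\<close>.\<close>

lemma pos_semidef_square_perturbation:
  fixes P Q :: "real^'n^'n"
  assumes P: "pos_semidef P" and Q: "pos_semidef Q"
    and close: "\<And>v. norm v = 1 \<Longrightarrow> \<bar>v \<bullet> ((P ** P - Q ** Q) *v v)\<bar> \<le> \<kappa>"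
  shows "(norm (P - Q))\<^sup>2 \<le> real CARD('n) * \<kappa>"
proof -
  have sym: "transpose P = P" "transpose Q = Q" using P Q by (auto simp: pos_semidef_def)
  then have "transpose (P - Q) = P - Q" by (simp add: transpose_def vec_eq_iff)
  from symmetric_extremal_eigenvector[OF this] obtain v \<mu> where
    v: "norm v = 1" "(P - Q) *v v = \<mu> *\<^sub>R v" "\<And>w. norm ((P - Q) *v w) \<le> \<bar>\<mu>\<bar> * norm w"
    by blast
  have e: "P *v v = Q *v v + \<mu> *\<^sub>R v"
    using v(2) by (simp add: matrix_vector_mult_diff_rdistrib algebra_simps)
  have vv: "v \<bullet> v = 1" using v(1) by (simp add: norm_eq_1)
  define p q where "p = v \<bullet> (P *v v)" and "q = v \<bullet> (Q *v v)"
  have pq: "p \<ge> 0" "q \<ge> 0" using P Q by (auto simp: p_def q_def pos_semidef_def)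
  have d: "p - q = \<mu>" by (simp add: p_def q_def e inner_add_right vv)
  have "v \<bullet> ((P ** P - Q ** Q) *v v) = (P *v v) \<bullet> (P *v v) - (Q *v v) \<bullet> (Q *v v)"
    by (simp add: matrix_vector_mult_diff_rdistrib inner_diff_right matrix_vector_mul_assoc[symmetric]
        symmetric_dot[OF sym(1)] symmetric_dot[OF sym(2)])
  also have "\<dots> = \<mu> * (p + q)"
    by (simp add: p_def q_def e inner_add_left inner_add_right vv algebra_simps inner_commute)
  finally have "\<bar>\<mu>\<bar> * (p + q) \<le> \<kappa>"
    using close[OF v(1)] pq by (simp add: abs_mult)
  moreover have "\<bar>\<mu>\<bar> * \<bar>\<mu>\<bar> \<le> \<bar>\<mu>\<bar> * (p + q)" using pq d by (intro mult_left_mono) auto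
  ultimately have \<mu>: "\<mu>\<^sup>2 \<le> \<kappa>" by (simp add: power2_eq_square)
  have "(norm (column j (P - Q)))\<^sup>2 \<le> \<kappa>" for j
  proof -
    have "norm (column j (P - Q)) \<le> \<bar>\<mu>\<bar>"
      using v(3)[of "axis j 1"] by (simp add: norm_axis_1 matrix_vector_mult_basis)
    then have "(norm (column j (P - Q)))\<^sup>2 \<le> \<bar>\<mu>\<bar>\<^sup>2" by (intro power_mono) auto
    then show ?thesis using \<mu> by simp
  qed
  then have "(\<Sum>j\<in>UNIV. (norm (column j (P - Q)))\<^sup>2) \<le> (\<Sum>j\<in>(UNIV::'n set). \<kappa>)"
    by (intro sum_mono) auto
  then show ?thesis by (simp add: norm_sq_matrix_columns)
qed

lemma pos_semidef_sqrt_unique: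
  assumes "pos_semidef P" "pos_semidef Q" "P ** P = Q ** Q"
  shows "P = Q"
  using pos_semidef_square_perturbation[OF assms(1,2), of 0] assms(3) by simp

text \<open>Cholesky factorisation: one step of symmetric Gaussian elimination clears row \<open>k\<close>.\<close>

lemma pos_semidef_factor_supported:
  fixes T :: "real^'n^'n"
  assumes "finite J" "pos_semidef T" "\<And>i j. i \<notin> J \<Longrightarrow> T $ i $ j = 0"
  shows "\<exists>M. T = M ** transpose M \<and> (\<forall>i j. j \<notin> J \<longrightarrow> M $ i $ j = 0)"
  using assms
proof (induction J arbitrary: T rule: finite_induct)
  case empty
  then show ?case
    by (intro exI[of _ "0 :: real^'n^'n"]) (simp add: vec_eq_iff matrix_matrix_mult_def)
next
  case (insert k J)
  have symT: "transpose T = T" using insert.prems(1) by (simp add: pos_semidef_def)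
  note sym = symmetric_nth[OF symT]
  define e where "e = (axis k 1 :: real^'n)"
  define t where "t = T *v e"
  define d where "d = T $ k $ k"
  have t: "t $ i = T $ i $ k" for i
    by (simp add: t_def e_def matrix_vector_mult_basis column_def)
  have eT: "e \<bullet> (T *v v) = t \<bullet> v" for v
    by (simp add: t_def symmetric_dot[OF symT])
  have d: "e \<bullet> t = d" by (simp add: e_def inner_axis' t d_def)
  have "d \<ge> 0" using insert.prems(1) d unfolding pos_semidef_def t_def by metis
  show ?case
  proof (cases "d = 0")
    case True
    \<comment> \<open>A zero pivot forces the whole row to vanish, so the matrix is already
      supported on \<open>J\<close>.\<close>
    have "t = 0" using pos_semidef_null[OF insert.prems(1), of e] True d by (simp add: t_def)
    then have "T $ k $ j = 0" for j using t sym by (metis zero_index)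
    then have "\<And>i j. i \<notin> J \<Longrightarrow> T $ i $ j = 0" using insert.prems(2) by (metis insertE)
    from insert.IH[OF insert.prems(1) this] show ?thesis by blast
  next
    case False
    then have "d > 0" using \<open>d \<ge> 0\<close> by simp
    \<comment> \<open>The Schur complement of the pivot. Its form at \<open>v\<close> is the minimum
      of the form of \<open>T\<close> on the line \<open>v + s *\<^sub>R e\<close>, attained at the
      \<open>s\<close> chosen below, hence it stays nonnegative.\<close>
    define T' where "T' = (\<chi> i j. T $ i $ j - T $ i $ k * T $ j $ k / d)"
    have T': "T' *v v = T *v v - ((t \<bullet> v) / d) *\<^sub>R t" for v
      by (simp add: vec_eq_iff T'_def matrix_vector_mult_def inner_vec_def t left_diff_distrib
          sum_subtractf sum_distrib_right sum_distrib_left sum_divide_distrib algebra_simps)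
    have "pos_semidef T'"
      unfolding pos_semidef_def
    proof
      show "transpose T' = T'"
        by (simp add: T'_def transpose_def vec_eq_iff mult.commute) (metis sym)
      show "\<forall>v. 0 \<le> v \<bullet> (T' *v v)"
      proof
        fix v
        define s where "s = - (t \<bullet> v) / d"
        have "0 \<le> (v + s *\<^sub>R e) \<bullet> (T *v (v + s *\<^sub>R e))"
          using insert.prems(1) by (simp add: pos_semidef_def)
        also have "\<dots> = v \<bullet> (T *v v) + 2 * s * (t \<bullet> v) + s * s * d"
          by (simp add: matrix_vector_right_distrib matrix_vector_mult_scaleR inner_add_left
              inner_add_right t_def[symmetric] eT d inner_commute algebra_simps)
        also have "\<dots> = v \<bullet> (T' *v v)"
          using \<open>d > 0\<close> by (simp add: T' s_def inner_diff_right inner_commute)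
        finally show "0 \<le> v \<bullet> (T' *v v)" .
      qed
    qed
    moreover have "T' $ i $ j = 0" if "i \<notin> J" for i j
    proof (cases "i = k")
      case True
      then show ?thesis using \<open>d > 0\<close> sym[of k j] by (simp add: T'_def d_def)
    next
      case False
      then show ?thesis using that insert.prems(2) by (simp add: T'_def)
    qed
    ultimately obtain M where M: "T' = M ** transpose M" "\<And>i j. j \<notin> J \<Longrightarrow> M $ i $ j = 0"
      using insert.IH[of T'] by blast
    \<comment> \<open>Column \<open>k\<close> of \<open>M\<close> is zero because
      \<open>k \<notin> J\<close>; the vector \<open>t\<close> divided by \<open>sqrt d\<close>
      takes its place, and its outer product restores the rank-one term that elimination
      removed.\<close>
    define N where "N = (\<chi> i j. if j = k then T $ i $ k / sqrt d else M $ i $ j)"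
    have "(\<Sum>l\<in>UNIV. N $ i $ l * N $ j $ l) = T $ i $ j" for i j
    proof -
      have "(\<Sum>l\<in>UNIV. N $ i $ l * N $ j $ l)
          = (\<Sum>l\<in>UNIV. (if l = k then T $ i $ k * T $ j $ k / d else 0) + M $ i $ l * M $ j $ l)"
        using M(2)[of k] insert.hyps(2) \<open>d > 0\<close> by (intro sum.cong) (auto simp: N_def)
      also have "\<dots> = T $ i $ k * T $ j $ k / d + T' $ i $ j"
        by (simp add: sum.distrib M(1) matrix_matrix_mult_def transpose_def)
      finally show ?thesis by (simp add: T'_def)
    qed
    then have "T = N ** transpose N"
      by (simp add: vec_eq_iff matrix_matrix_mult_def transpose_def)
    moreover have "\<forall>i j. j \<notin> insert k J \<longrightarrow> N $ i $ j = 0" using M(2) by (simp add: N_def)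
    ultimately show ?thesis by blast
  qed
qed

section \<open>Reflections, trace maximisation and the polar decomposition\<close>

definition householder :: "real^'n \<Rightarrow> real^'n^'n" where
  "householder u = (\<chi> i j. (if i = j then 1 else 0) - 2 * u $ i * u $ j)"

lemma householder_mult_vec: "householder u *v w = w - (2 * (u \<bullet> w)) *\<^sub>R u"
proof -
  have "(householder u *v w) $ i = (w - (2 * (u \<bullet> w)) *\<^sub>R u) $ i" for i
  proof -
    have "(householder u *v w) $ i
        = (\<Sum>j\<in>UNIV. (if i = j then w $ j else 0) - 2 * u $ i * (u $ j * w $ j))"
      by (auto simp: householder_def matrix_vector_mult_def algebra_simps intro!: sum.cong)
    also have "\<dots> = w $ i - 2 * u $ i * (u \<bullet> w)"
      by (simp add: sum_subtractf sum_distrib_left inner_vec_def)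
    finally show ?thesis by simp
  qed
  then show ?thesis by (simp add: vec_eq_iff)
qed

lemma orthogonal_householder:
  assumes "norm u = 1"
  shows "orthogonal_matrix (householder u)"
proof -
  have "transpose (householder u) = householder u"
    by (auto simp: householder_def transpose_def vec_eq_iff)
  moreover have "u \<bullet> u = 1" using assms by (simp add: norm_eq_1)
  then have "(householder u ** householder u) *v w = mat 1 *v w" for w
    by (simp add: matrix_vector_mul_assoc[symmetric] householder_mult_vec inner_diff_right scaleR_left_distrib[symmetric])
  then have "householder u ** householder u = mat 1" by (simp add: matrix_eq)
  ultimately show ?thesis by (simp add: orthogonal_matrix)
qed

lemma trace_householder_mult: "trace (householder u ** N) = trace N - 2 * (u \<bullet> (N *v u))"
proof -
  have "trace (householder u ** N)
      = (\<Sum>i\<in>UNIV. \<Sum>k\<in>UNIV. (if i = k then N $ k $ i else 0) - 2 * (u $ k * (N $ k $ i * u $ i)))"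
    by (auto simp: trace_def householder_def matrix_matrix_mult_def algebra_simps intro!: sum.cong)
  also have "\<dots> = trace N - 2 * (\<Sum>i\<in>UNIV. \<Sum>k\<in>UNIV. u $ k * (N $ k $ i * u $ i))"
    by (simp add: sum_subtractf trace_def sum_distrib_left)
  also have "(\<Sum>i\<in>UNIV. \<Sum>k\<in>UNIV. u $ k * (N $ k $ i * u $ i))
      = (\<Sum>k\<in>UNIV. \<Sum>i\<in>UNIV. u $ k * (N $ k $ i * u $ i))"
    by (rule sum.swap)
  also have "\<dots> = u \<bullet> (N *v u)"
    by (simp add: inner_vec_def matrix_vector_mult_def sum_distrib_left)
  finally show ?thesis .
qed

text \<open>Reflections as competitors give positivity. Products of two reflections in nearby vectors of
  the plane of \<open>axis i 1\<close> and \<open>axis j 1\<close> are small rotations and give symmetry.\<close>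

lemma pos_semidef_if_trace_maximal:
  fixes P :: "real^'n^'n"
  assumes max: "\<And>V. orthogonal_matrix V \<Longrightarrow> trace (V ** P) \<le> trace P"
  shows "pos_semidef P"
proof -
  have psd1: "0 \<le> u \<bullet> (P *v u)" if "norm u = 1" for u
    using max[OF orthogonal_householder[OF that]] by (simp add: trace_householder_mult)
  have psd: "0 \<le> v \<bullet> (P *v v)" for v
  proof (cases "v = 0")
    case False
    then show ?thesis using psd1[of "(1 / norm v) *\<^sub>R v"]
      by (simp add: matrix_vector_mult_scaleR zero_le_mult_iff zero_le_divide_iff mult_le_0_iff)
  qed simp
  \<comment> \<open>The competitor is \<open>householder u ** householder v\<close>; applying the
    trace formula twice gives exactly this expression.\<close>
  have two: "0 \<le> u \<bullet> (P *v u) + v \<bullet> (P *v v) - 2 * (u \<bullet> v) * (v \<bullet> (P *v u))"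
    if "norm u = 1" "norm v = 1" for u v
    using max[OF orthogonal_matrix_mul[OF orthogonal_householder orthogonal_householder], OF that]
    by (simp add: matrix_mul_assoc[symmetric] trace_householder_mult)
      (simp add: matrix_vector_mul_assoc[symmetric] householder_mult_vec inner_diff_right algebra_simps)
  have "P $ i $ j = P $ j $ i" if "i \<noteq> j" for i j
  proof (rule ccontr)
    define p where "p = P $ i $ i + P $ j $ j"
    define q where "q = P $ i $ j - P $ j $ i"
    assume "P $ i $ j \<noteq> P $ j $ i"
    then have "q \<noteq> 0" by (simp add: q_def)
    have ax: "axis k 1 \<bullet> (P *v axis l 1) = P $ k $ l" for k l
      by (simp add: matrix_vector_mult_basis column_def inner_axis')
    have "p \<ge> 0" using psd[of "axis i 1"] psd[of "axis j 1"] by (simp add: ax p_def)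
    \<comment> \<open>For \<open>u = axis i 1\<close> and the vector \<open>v\<close> below, the
      inequality \<open>two\<close> times \<open>r * r\<close> reads
      \<open>0 \<le> t * (t * p + q)\<close>. This \<open>t\<close> makes the right side minus a
      nonzero square; the 1 in the denominator covers \<open>p = 0\<close>.\<close>
    define t where "t = - q / (p + 1)"
    define r where "r = sqrt (1 + t\<^sup>2)"
    have r: "r > 0" "r * r = 1 + t * t"
      by (auto simp: r_def add_pos_nonneg power2_eq_square)
    define v where "v = (1 / r) *\<^sub>R (axis i 1 + t *\<^sub>R axis j (1::real))"
    have "v \<bullet> v = (1 + t * t) / (r * r)"
      using that by (simp add: v_def inner_add_left inner_add_right inner_axis_axis add_divide_distrib)
    then have "v \<bullet> v = 1" unfolding r(2) by (simp add: add_nonneg_eq_0_iff)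
    then have nv: "norm v = 1" by (simp add: norm_eq_1)
    have "v \<bullet> (P *v v) = (P $ i $ i + t * (P $ i $ j + P $ j $ i) + t * t * P $ j $ j) / (r * r)"
      by (simp add: v_def matrix_vector_right_distrib matrix_vector_mult_scaleR inner_add_left
          inner_add_right ax algebra_simps add_divide_distrib)
    moreover have "v \<bullet> (P *v axis i 1) = (P $ i $ i + t * P $ j $ i) / r"
      by (simp add: v_def inner_add_left ax)
    moreover have "axis i 1 \<bullet> v = 1 / r"
      using that by (simp add: v_def inner_add_right inner_axis_axis)
    ultimately have "0 \<le> P $ i $ i + (P $ i $ i + t * (P $ i $ j + P $ j $ i) + t * t * P $ j $ j) / (r * r)
        - 2 * (P $ i $ i + t * P $ j $ i) / (r * r)"
      using two[of "axis i 1" v, OF _ nv] by (simp add: ax)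
    then have "0 \<le> (P $ i $ i + (P $ i $ i + t * (P $ i $ j + P $ j $ i) + t * t * P $ j $ j) / (r * r)
        - 2 * (P $ i $ i + t * P $ j $ i) / (r * r)) * (r * r)"
      using r(1) by (intro mult_nonneg_nonneg) auto
    also have "\<dots> = P $ i $ i * (r * r) + (P $ i $ i + t * (P $ i $ j + P $ j $ i) + t * t * P $ j $ j)
        - 2 * (P $ i $ i + t * P $ j $ i)"
      using r(1) by (simp add: field_simps)
    also have "\<dots> = t * (t * p + q)"
      unfolding r(2) by (simp add: p_def q_def algebra_simps)
    also have "t * p + q = q / (p + 1)"
      using \<open>p \<ge> 0\<close> by (simp add: t_def field_simps)
    also have "t * (q / (p + 1)) = - (q / (p + 1))\<^sup>2"
      by (simp add: t_def power2_eq_square)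
    finally show False using \<open>q \<noteq> 0\<close> \<open>p \<ge> 0\<close> by simp
  qed
  then have "transpose P = P" by (simp add: transpose_def vec_eq_iff) metis
  then show ?thesis using psd by (simp add: pos_semidef_def)
qed

lemma inner_matrix_eq_trace:
  fixes A B :: "real^'n^'m"
  shows "A \<bullet> B = trace (transpose A ** B)"
  by (simp add: inner_vec_def trace_def matrix_matrix_mult_def transpose_def) (rule sum.swap)

lemma norm_orthogonal_matrix_mult:
  fixes U A :: "real^'n^'n"
  assumes "orthogonal_matrix U"
  shows "norm (U ** A) = norm A"
proof -
  have "transpose (U ** A) ** (U ** A) = transpose A ** (transpose U ** U) ** A"
    by (simp add: matrix_transpose_mul matrix_mul_assoc)
  then show ?thesis
    using assms by (simp add: norm_eq_sqrt_inner inner_matrix_eq_trace orthogonal_matrix)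
qed

lemma compact_orthogonal_matrices: "compact {U :: real^'n^'n. orthogonal_matrix U}"
proof (rule compact_eq_bounded_closed[THEN iffD2], intro conjI)
  have "norm U = norm (mat 1 :: real^'n^'n)" if "orthogonal_matrix U" for U :: "real^'n^'n"
    using norm_orthogonal_matrix_mult[OF that, of "mat 1"] by simp
  then show "bounded {U :: real^'n^'n. orthogonal_matrix U}"
    unfolding bounded_iff by (metis mem_Collect_eq order_refl)
  have "{U :: real^'n^'n. orthogonal_matrix U}
      = {U. \<forall>i j. (\<Sum>k\<in>UNIV. U $ k $ i * U $ k $ j) = (if i = j then 1 else 0)}"
    by (simp add: orthogonal_matrix vec_eq_iff matrix_matrix_mult_def transpose_def mat_def)
  also have "closed \<dots>"
    by (intro closed_Collect_all closed_Collect_eq continuous_intros)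
  finally show "closed {U :: real^'n^'n. orthogonal_matrix U}" .
qed

text \<open>The orthogonal factor is a maximiser of the trace, which exists by compactness; since
  products of orthogonal matrices are orthogonal, the identity is then optimal for
  \<open>U ** M\<close>. The maximality is kept as a conclusion because it also identifies the
  optimal \<open>U\<close> in \<open>d_cov\<close>.\<close>

lemma polar_decomposition:
  fixes M :: "real^'n^'n"
  obtains U where "orthogonal_matrix U" "pos_semidef (U ** M)"
    "\<And>V. orthogonal_matrix V \<Longrightarrow> trace (V ** M) \<le> trace (U ** M)"
proof -
  have "continuous_on {U. orthogonal_matrix U} (\<lambda>U. trace (U ** M))"
    unfolding trace_def matrix_matrix_mult_def by (auto intro!: continuous_intros)
  moreover have "{U :: real^'n^'n. orthogonal_matrix U} \<noteq> {}"
    using orthogonal_matrix_id by blast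
  ultimately obtain U where U: "orthogonal_matrix U"
    and max: "\<And>V. orthogonal_matrix V \<Longrightarrow> trace (V ** M) \<le> trace (U ** M)"
    using continuous_attains_sup[OF compact_orthogonal_matrices, of "\<lambda>U. trace (U ** M)"] by auto
  have "pos_semidef (U ** M)"
    by (rule pos_semidef_if_trace_maximal)
      (simp add: matrix_mul_assoc max orthogonal_matrix_mul U)
  with U max show ?thesis using that by blast
qed

text \<open>Symmetry allows one factor to be transposed, after which \<open>U\<close> cancels:
  \<open>U ** M\<close> is the square root of \<open>transpose M ** M\<close>.\<close>

lemma square_polar_factor:
  fixes U M :: "real^'n^'n"
  assumes "orthogonal_matrix U" "pos_semidef (U ** M)"
  shows "(U ** M) ** (U ** M) = transpose M ** M"
proof -
  have "(U ** M) ** (U ** M) = transpose (U ** M) ** (U ** M)"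
    using assms(2) by (simp add: pos_semidef_def)
  also have "\<dots> = transpose M ** (transpose U ** U) ** M"
    by (simp add: matrix_transpose_mul matrix_mul_assoc)
  finally show ?thesis using assms(1) by (simp add: orthogonal_matrix)
qed

section \<open>Existence and uniqueness of the positive semidefinite square root\<close>

lemma matrix_sqrt_eqI:
  assumes "pos_semidef P" "P ** P = S"
  shows "matrix_sqrt S = P"
  unfolding matrix_sqrt_def
  by (rule the_equality) (use assms pos_semidef_sqrt_unique in auto)

text \<open>Existence combines the two factorisations: \<open>S = M ** transpose M\<close>, and the
  positive semidefinite polar factor of \<open>transpose M\<close> squares to that product.\<close>

lemma matrix_sqrt:
  fixes S :: "real^'n^'n"
  assumes "pos_semidef S"
  shows "pos_semidef (matrix_sqrt S)" "matrix_sqrt S ** matrix_sqrt S = S"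
proof -
  obtain M :: "real^'n^'n" where M: "S = M ** transpose M"
    using pos_semidef_factor_supported[OF finite assms, of UNIV] by auto
  obtain U where "orthogonal_matrix U" "pos_semidef (U ** transpose M)"
    using polar_decomposition[of "transpose M"] by blast
  with square_polar_factor[OF this] M have "pos_semidef (U ** transpose M)"
    "(U ** transpose M) ** (U ** transpose M) = S" by auto
  with matrix_sqrt_eqI[OF this] show "pos_semidef (matrix_sqrt S)" "matrix_sqrt S ** matrix_sqrt S = S"
    by auto
qed

section \<open>The distance between covariance matrices\<close>

text \<open>The orthogonal Procrustes problem. With \<open>P\<close>, \<open>Q\<close> the two
  roots, the square of \<open>norm (P - V ** Q)\<close> is
  \<open>trace S1 + trace S2 - 2 * trace (V ** (Q ** P))\<close>. The \<open>U\<close> maximising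
  the last trace turns \<open>U ** (Q ** P)\<close> into the square root of
  \<open>P ** S2 ** P\<close>, which is the matrix in the definition of
  \<open>d_cov\<close>.\<close>

lemma d_cov_orthogonal_min:
  fixes S1 S2 :: "real^'n^'n"
  assumes S: "pos_semidef S1" "pos_semidef S2"
  obtains U where "orthogonal_matrix U" "d_cov S1 S2 = norm (matrix_sqrt S1 - U ** matrix_sqrt S2)"
    "\<And>V. orthogonal_matrix V \<Longrightarrow> d_cov S1 S2 \<le> norm (matrix_sqrt S1 - V ** matrix_sqrt S2)"
proof -
  define P Q where "P = matrix_sqrt S1" and "Q = matrix_sqrt S2"
  have P: "pos_semidef P" "transpose P = P" "P ** P = S1"
    and Q: "pos_semidef Q" "transpose Q = Q" "Q ** Q = S2"
    using matrix_sqrt[OF S(1)] matrix_sqrt[OF S(2)] by (auto simp: P_def Q_def pos_semidef_def)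
  obtain U where U: "orthogonal_matrix U" "pos_semidef (U ** (Q ** P))"
    and max: "\<And>V. orthogonal_matrix V \<Longrightarrow> trace (V ** (Q ** P)) \<le> trace (U ** (Q ** P))"
    using polar_decomposition[of "Q ** P"] by blast
  have "transpose (Q ** P) ** (Q ** P) = P ** S2 ** P"
    by (simp add: matrix_transpose_mul P(2) Q(2) Q(3)[symmetric] matrix_mul_assoc)
  then have sq: "matrix_sqrt (P ** S2 ** P) = U ** (Q ** P)"
    using matrix_sqrt_eqI[OF U(2)] square_polar_factor[OF U] by simp
  have trS: "trace (c *\<^sub>R A) = c * trace A" for c and A :: "real^'n^'n"
    by (simp add: trace_def sum_distrib_left)
  have d: "d_cov S1 S2 = sqrt (trace S1 + trace S2 - 2 * trace (U ** (Q ** P)))"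
    by (simp add: d_cov_def P_def[symmetric] sq trace_add trace_sub trS)
  have n: "norm (P - V ** Q) = sqrt (trace S1 + trace S2 - 2 * trace (V ** (Q ** P)))"
    if V: "orthogonal_matrix V" for V
  proof -
    have "(norm (V ** Q))\<^sup>2 = trace S2"
      using norm_orthogonal_matrix_mult[OF V, of Q]
      by (simp add: power2_norm_eq_inner inner_matrix_eq_trace Q)
    moreover have "(norm P)\<^sup>2 = trace S1"
      by (simp add: power2_norm_eq_inner inner_matrix_eq_trace P)
    moreover have "P \<bullet> (V ** Q) = trace (V ** (Q ** P))"
      by (simp add: inner_matrix_eq_trace P(2) trace_mul_sym[of P] matrix_mul_assoc[symmetric])
    ultimately have "(norm (P - V ** Q))\<^sup>2 = trace S1 + trace S2 - 2 * trace (V ** (Q ** P))"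
      by (simp add: power2_norm_eq_inner inner_diff_left inner_diff_right inner_commute)
    then show ?thesis by (metis norm_ge_zero real_sqrt_unique)
  qed
  have "d_cov S1 S2 = norm (P - U ** Q)" using n[OF U(1)] d by simp
  moreover have "d_cov S1 S2 \<le> norm (P - V ** Q)" if "orthogonal_matrix V" for V
    unfolding d n[OF that] using max[OF that] by simp
  ultimately show ?thesis using that U(1) by (simp add: P_def Q_def)
qed

section \<open>Pseudometric properties and stability of \<open>d_cov\<close>\<close>

lemma matrix_diff_ldistrib:
  fixes A :: "'a::ring_1^'n^'m"
  shows "A ** (B - C) = A ** B - A ** C"
  by (simp add: vec_eq_iff matrix_matrix_mult_def right_diff_distrib sum_subtractf)

text \<open>The product of the two optimal orthogonal matrices is a competitor for the outer pair,
  and left multiplication by \<open>U\<close> preserves the norm.\<close>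

lemma d_cov_triangle:
  assumes "pos_semidef S1" "pos_semidef S2" "pos_semidef S3"
  shows "d_cov S1 S3 \<le> d_cov S1 S2 + d_cov S2 S3"
proof -
  define P Q R where "P = matrix_sqrt S1" and "Q = matrix_sqrt S2" and "R = matrix_sqrt S3"
  obtain U where U: "orthogonal_matrix U" "d_cov S1 S2 = norm (P - U ** Q)"
    using d_cov_orthogonal_min[OF assms(1,2)] unfolding P_def Q_def by blast
  obtain V where V: "orthogonal_matrix V" "d_cov S2 S3 = norm (Q - V ** R)"
    using d_cov_orthogonal_min[OF assms(2,3)] unfolding Q_def R_def by blast
  have "d_cov S1 S3 \<le> norm (P - (U ** V) ** R)"
    using d_cov_orthogonal_min[OF assms(1,3)] orthogonal_matrix_mul[OF U(1) V(1)]
    unfolding P_def R_def by blast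
  also have "P - (U ** V) ** R = (P - U ** Q) + U ** (Q - V ** R)"
    by (simp add: matrix_diff_ldistrib matrix_mul_assoc)
  also have "norm \<dots> \<le> norm (P - U ** Q) + norm (U ** (Q - V ** R))"
    by (rule norm_triangle_ineq)
  finally show ?thesis
    by (simp only: U V norm_orthogonal_matrix_mult[OF U(1)])
qed

text \<open>The transpose of an optimal matrix for one order is a competitor of equal cost for the
  other order.\<close>

lemma d_cov_commute:
  assumes "pos_semidef S1" "pos_semidef S2"
  shows "d_cov S1 S2 = d_cov S2 S1"
proof -
  have "d_cov S T \<le> d_cov T S" if ST: "pos_semidef S" "pos_semidef T" for S T :: "real^'n^'n"
  proof -
    obtain U where U: "orthogonal_matrix U" "d_cov T S = norm (matrix_sqrt T - U ** matrix_sqrt S)"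
      using d_cov_orthogonal_min[OF ST(2,1)] by blast
    have U': "orthogonal_matrix (transpose U)" "transpose U ** U = mat 1"
      using U(1) by (auto simp: orthogonal_matrix_def)
    have "d_cov S T \<le> norm (matrix_sqrt S - transpose U ** matrix_sqrt T)"
      using d_cov_orthogonal_min[OF ST] U'(1) by blast
    also have "\<dots> = norm (transpose U ** (matrix_sqrt T - U ** matrix_sqrt S))"
      using U'(2) by (simp add: matrix_diff_ldistrib matrix_mul_assoc norm_minus_commute)
    finally show ?thesis by (simp only: U norm_orthogonal_matrix_mult[OF U'(1)])
  qed
  with assms show ?thesis by (meson antisym)
qed

text \<open>The identity is a competitor in the orthogonal minimum, so the distance is at most that
  of the two square roots, to which the perturbation bound applies.\<close>

lemma d_cov_perturbation:
  fixes S1 S2 :: "real^'n^'n"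
  assumes S: "pos_semidef S1" "pos_semidef S2"
    and close: "\<And>v. norm v = 1 \<Longrightarrow> \<bar>v \<bullet> ((S1 - S2) *v v)\<bar> \<le> \<kappa>"
  shows "d_cov S1 S2 \<le> sqrt (real CARD('n) * \<kappa>)"
proof -
  have "d_cov S1 S2 \<le> norm (matrix_sqrt S1 - mat 1 ** matrix_sqrt S2)"
    using d_cov_orthogonal_min[OF S] orthogonal_matrix_id by blast
  moreover have "(norm (matrix_sqrt S1 - matrix_sqrt S2))\<^sup>2 \<le> real CARD('n) * \<kappa>"
    using S close by (intro pos_semidef_square_perturbation) (auto simp: matrix_sqrt)
  ultimately show ?thesis using real_le_rsqrt by fastforce
qed

section \<open>Probability measures with full support\<close>

text \<open>A point outside the support lies in a basic open set of measure zero, and there are only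
  countably many of these. The assumption on the identity says that traces of open sets are
  measurable.\<close>

lemma AE_in_measure_support:
  fixes M :: "'a::second_countable_topology measure"
  assumes id: "(\<lambda>x. x) \<in> borel_measurable M"
  shows "AE x in M. x \<in> measure_support M"
proof -
  obtain B :: "'a set set" where B: "countable B" "topological_basis B"
    using ex_countable_basis by blast
  have sets: "U \<inter> space M \<in> sets M" if "open U" for U
    using measurable_sets[OF id, of U] that by (simp add: Int_def)
  define N where "N = {U \<in> B. emeasure M (U \<inter> space M) = 0}"
  have "AE x in M. \<forall>U\<in>N. x \<notin> U"
  proof (subst AE_ball_countable)
    show "countable N" using B(1) by (auto simp: N_def)
    have "AE x in M. x \<notin> U" if "U \<in> N" for U
    proof -
      have "U \<inter> space M \<in> null_sets M"
        using that sets[of U] B(2) topological_basis_open by (auto simp: N_def null_sets_def)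
      from AE_not_in[OF this] AE_space show ?thesis by eventually_elim auto
    qed
    then show "\<forall>U\<in>N. AE x in M. x \<notin> U" by blast
  qed
  with AE_space show ?thesis
  proof eventually_elim
    case (elim x)
    show ?case
      unfolding measure_support_def
    proof (intro CollectI conjI allI impI)
      fix V assume V: "open V \<and> x \<in> V"
      then obtain U where U: "U \<in> B" "x \<in> U" "U \<subseteq> V"
        using topological_basisE[OF B(2), of V x] by blast
      then have "0 < emeasure M (U \<inter> space M)" using elim(2) by (auto simp: N_def zero_less_iff_neq_zero)
      also have "\<dots> \<le> emeasure M (V \<inter> space M)" using U V sets by (intro emeasure_mono) auto
      finally show "0 < emeasure M (V \<inter> space M)" .
    qed (fact elim(1))
  qed
qed

section \<open>Measures of full support and their metric balls\<close>

lemma full_prob_measuresD: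
  assumes "\<alpha> \<in> full_prob_measures X"
  shows "prob_space \<alpha>" "space \<alpha> = X" "(\<lambda>x. x) \<in> borel_measurable \<alpha>"
    and sets_restrict_full_prob_measure: "sets \<alpha> = sets (restrict_space borel X)"
proof -
  show "prob_space \<alpha>" and s: "sets \<alpha> = sets (restrict_space borel X)"
    using assms by (auto simp: full_prob_measures_def)
  then show "space \<alpha> = X" using sets_eq_imp_space_eq[OF s] by (simp add: space_restrict_space)
  show "(\<lambda>x. x) \<in> borel_measurable \<alpha>"
    unfolding measurable_cong_sets[OF s refl] by (intro measurable_restrict_space1) simp
qed

lemma metric_ball_measurable:
  fixes X :: "'a::metric_space set"
  assumes "sets \<alpha> = sets (restrict_space borel X)"
  shows "metric_ball X x r \<in> sets \<alpha>"
proof -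
  have "metric_ball X x r = X \<inter> cball x r" by (auto simp: metric_ball_def)
  then show ?thesis unfolding assms sets_restrict_space by (auto simp: closed_cball borel_closed)
qed

lemma measure_metric_ball_pos:
  assumes \<alpha>: "\<alpha> \<in> full_prob_measures X" and "x \<in> X" "r > 0"
  shows "measure \<alpha> (metric_ball X x r) > 0"
proof -
  interpret prob_space \<alpha> using full_prob_measuresD[OF \<alpha>] by simp
  have "x \<in> measure_support \<alpha>" using assms by (simp add: full_prob_measures_def)
  then have "0 < emeasure \<alpha> (ball x r \<inter> space \<alpha>)"
    using \<open>r > 0\<close> by (simp add: measure_support_def)
  also have "\<dots> \<le> emeasure \<alpha> (metric_ball X x r)"
    using metric_ball_measurable[OF sets_restrict_full_prob_measure[OF \<alpha>]]
    by (intro emeasure_mono) (auto simp: metric_ball_def full_prob_measuresD(2)[OF \<alpha>])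
  finally show ?thesis by (simp add: emeasure_eq_measure)
qed

section \<open>Averages over balls and variances of linear functionals\<close>

lemma integral_uniform_measure:
  fixes f :: "'a \<Rightarrow> real"
  assumes "A \<in> sets M" "measure M A > 0" "f \<in> borel_measurable M"
  shows "(LINT x|uniform_measure M A. f x) = (LINT x|M. indicator A x * f x) / measure M A"
proof -
  \<comment> \<open>\<open>measure\<close> is 0 on sets of infinite measure, so positivity already
    implies finiteness.\<close>
  have "emeasure M A \<noteq> top" using assms(2) by (auto simp: measure_def)
  then have "emeasure M A = ennreal (measure M A)" by (rule emeasure_eq_ennreal_measure)
  then have "uniform_measure M A = density M (\<lambda>x. ennreal (indicator A x / measure M A))"
    using assms(2) unfolding uniform_measure_def
    by (intro arg_cong[where f = "density M"]) (auto simp: fun_eq_iff indicator_def divide_ennreal[of 1, simplified])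
  then show ?thesis
    using assms by (simp add: integral_density)
qed

text \<open>The quadratic form is the variance of \<open>v \<bullet> y\<close>, which may be
  expanded about any point \<open>z\<close>. The freedom in \<open>z\<close> matters later: the
  centre of the ball serves for both measures, while their means differ.\<close>

lemma
  fixes M :: "(real^'n) measure"
  assumes "prob_space M" and meas: "(\<lambda>y. y) \<in> borel_measurable M"
    and bounded: "AE y in M. norm y \<le> K"
  shows quadratic_form_cov_matrix:
      "v \<bullet> (cov_matrix M *v v) = (LINT y|M. (v \<bullet> (y - z))\<^sup>2) - (LINT y|M. v \<bullet> (y - z))\<^sup>2"
    and pos_semidef_cov_matrix: "pos_semidef (cov_matrix M)"
proof -
  interpret prob_space M by fact
  define \<mu> where "\<mu> = mean_vec M"
  have meas_cont: "f \<in> borel_measurable M" if "continuous_on UNIV f" for f :: "real^'n \<Rightarrow> real"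
    using measurable_compose[OF meas borel_measurable_continuous_onI[OF that]] .
  have int: "integrable M (\<lambda>y. y)"
    by (rule integrable_const_bound[OF bounded meas])
  have int_nth: "integrable M (\<lambda>y. (y $ i - \<mu> $ i) * (y $ j - \<mu> $ j))" for i j
  proof (rule integrable_const_bound)
    show "AE y in M. norm ((y $ i - \<mu> $ i) * (y $ j - \<mu> $ j)) \<le> (K + norm \<mu>) * (K + norm \<mu>)"
      using bounded
    proof eventually_elim
      case (elim y)
      have "\<bar>y $ i - \<mu> $ i\<bar> \<le> K + norm \<mu>" for i
        using component_le_norm_cart[of y i] component_le_norm_cart[of \<mu> i] elim by linarith
      then show ?case
        unfolding real_norm_def abs_mult by (intro mult_mono) (auto intro: order_trans[OF abs_ge_zero])
    qed
    show "(\<lambda>y. (y $ i - \<mu> $ i) * (y $ j - \<mu> $ j)) \<in> borel_measurable M"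
      by (intro meas_cont continuous_intros)
  qed
  have centred: "v \<bullet> (cov_matrix M *v v) = (LINT y|M. (v \<bullet> (y - \<mu>))\<^sup>2)" for v
  proof -
    have "(LINT y|M. (v \<bullet> (y - \<mu>))\<^sup>2)
        = (LINT y|M. (\<Sum>i\<in>UNIV. \<Sum>j\<in>UNIV. v $ i * v $ j * ((y $ i - \<mu> $ i) * (y $ j - \<mu> $ j))))"
      by (simp add: inner_vec_def power2_eq_square sum_product mult_ac)
    also have "\<dots> = (\<Sum>i\<in>UNIV. \<Sum>j\<in>UNIV. v $ i * v $ j * (LINT y|M. (y $ i - \<mu> $ i) * (y $ j - \<mu> $ j)))"
      using int_nth by simp
    also have "\<dots> = v \<bullet> (cov_matrix M *v v)"
      by (simp add: cov_matrix_def \<mu>_def inner_vec_def matrix_vector_mult_def sum_distrib_left mult_ac)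
    finally show ?thesis by simp
  qed
  show "pos_semidef (cov_matrix M)"
    unfolding pos_semidef_def
  proof
    show "transpose (cov_matrix M) = cov_matrix M"
      by (simp add: cov_matrix_def transpose_def vec_eq_iff mult.commute)
    show "\<forall>v. 0 \<le> v \<bullet> (cov_matrix M *v v)" by (simp add: centred)
  qed
  define f where "f y = v \<bullet> (y - z)" for y
  have f_int: "integrable M f" unfolding f_def using int by simp
  have f2_int: "integrable M (\<lambda>y. (f y)\<^sup>2)"
  proof (rule integrable_const_bound)
    show "AE y in M. norm ((f y)\<^sup>2) \<le> (norm v * (K + norm z))\<^sup>2"
      using bounded
    proof eventually_elim
      case (elim y)
      have "norm (y - z) \<le> K + norm z" using norm_triangle_ineq4[of y z] elim by linarith
      then have "\<bar>f y\<bar> \<le> norm v * (K + norm z)"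
        unfolding f_def by (meson Cauchy_Schwarz_ineq2 order_trans mult_left_mono norm_ge_zero)
      then show ?case using power_mono[of "\<bar>f y\<bar>" _ 2] by simp
    qed
    show "(\<lambda>y. (f y)\<^sup>2) \<in> borel_measurable M"
      unfolding f_def by (intro meas_cont continuous_intros)
  qed
  define m where "m = (LINT y|M. f y)"
  have m: "m = v \<bullet> \<mu> - v \<bullet> z"
    unfolding m_def f_def \<mu>_def mean_vec_def inner_diff_right using int prob_space
    by (cases "v = 0") auto
  have "v \<bullet> (y - \<mu>) = f y - m" for y by (simp add: m f_def inner_diff_right)
  moreover have "(f y - m)\<^sup>2 = (f y)\<^sup>2 - 2 * m * f y + m\<^sup>2" for y
    by (simp add: power2_eq_square algebra_simps)
  ultimately have "v \<bullet> (cov_matrix M *v v) = (LINT y|M. (f y)\<^sup>2 - 2 * m * f y + m\<^sup>2)"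
    unfolding centred by simp
  also have "\<dots> = (LINT y|M. (f y)\<^sup>2) - 2 * m * m + m\<^sup>2"
    using f_int f2_int by (simp add: prob_space m_def)
  finally show "v \<bullet> (cov_matrix M *v v) = (LINT y|M. (v \<bullet> (y - z))\<^sup>2) - (LINT y|M. v \<bullet> (y - z))\<^sup>2"
    unfolding m_def f_def by (simp add: power2_eq_square)
qed

section \<open>Control functions\<close>

text \<open>The largest relative excess of mass that the doubling condition allows when the radius
  grows from \<open>\<epsilon>\<close> to \<open>\<epsilon> + t\<close>.\<close>

definition growth :: "real \<Rightarrow> real \<Rightarrow> real \<Rightarrow> real" where
  "growth \<Lambda> \<epsilon> t = (1 + t / \<epsilon>) powr \<Lambda> - 1"

lemma growth_nonneg: "\<epsilon> > 0 \<Longrightarrow> \<Lambda> \<ge> 0 \<Longrightarrow> t \<ge> 0 \<Longrightarrow> growth \<Lambda> \<epsilon> t \<ge> 0"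
  by (simp add: growth_def ge_one_powr_ge_zero)

lemma growth_mono: "\<epsilon> > 0 \<Longrightarrow> \<Lambda> \<ge> 0 \<Longrightarrow> 0 \<le> s \<Longrightarrow> s \<le> t \<Longrightarrow> growth \<Lambda> \<epsilon> s \<le> growth \<Lambda> \<epsilon> t"
  unfolding growth_def by (intro diff_right_mono powr_mono2) (auto simp: divide_right_mono)

section \<open>Monotonicity and lower bounds for the control function\<close>

lemma Psi_fun_eq:
  "Psi_fun m c A \<Lambda> D \<epsilon> t =
     (\<epsilon> ^ m * unit_ball_vol (real m) * c * A) / psi_vol \<Lambda> D \<epsilon> * t
     + \<epsilon>\<^sup>2 / (psi_vol \<Lambda> D \<epsilon>)\<^sup>2 * (growth \<Lambda> \<epsilon> (sqrt t) + sqrt t)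
     + 2 * \<epsilon> * (1 + 2 * \<epsilon>) * (sqrt t / psi_vol \<Lambda> D \<epsilon> + growth \<Lambda> \<epsilon> (sqrt t))"
  by (simp add: Psi_fun_def Phi_fun_def Phi_base_def Psi_base_def growth_def)

lemma psi_vol_bounds:
  assumes "\<epsilon> > 0" "D \<ge> 0"
  shows "0 < psi_vol \<Lambda> D \<epsilon>" "psi_vol \<Lambda> D \<epsilon> \<le> 1"
  using assms by (auto simp: psi_vol_def)

lemma Psi_fun_zero: "\<epsilon> > 0 \<Longrightarrow> Psi_fun m c A \<Lambda> D \<epsilon> 0 = 0"
  by (simp add: Psi_fun_eq growth_def)

text \<open>Strictness comes from the linear term, whose coefficient is positive; the other summands
  are compared weakly.\<close>

lemma strict_mono_on_Psi_fun:
  assumes "\<epsilon> > 0" "D \<ge> 0" "c > 0" "\<Lambda> > 0" "A > 0"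
  shows "strict_mono_on {0..} (Psi_fun m c A \<Lambda> D \<epsilon>)"
proof (rule strict_mono_onI)
  fix s t :: real
  assume st: "s \<in> {0..}" "t \<in> {0..}" "s < t"
  note \<psi> = psi_vol_bounds[OF assms(1,2), of \<Lambda>]
  have g: "growth \<Lambda> \<epsilon> (sqrt s) \<le> growth \<Lambda> \<epsilon> (sqrt t)"
    using assms st by (intro growth_mono) auto
  show "Psi_fun m c A \<Lambda> D \<epsilon> s < Psi_fun m c A \<Lambda> D \<epsilon> t"
    unfolding Psi_fun_eq
  proof (intro add_less_le_mono mult_strict_left_mono mult_left_mono add_mono divide_right_mono g)
    show "0 < \<epsilon> ^ m * unit_ball_vol (real m) * c * A / psi_vol \<Lambda> D \<epsilon>"
      using assms \<psi> by simp
  qed (use assms st \<psi> in auto)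
qed

lemma Psi_fun_nonneg:
  assumes "\<epsilon> > 0" "D \<ge> 0" "c > 0" "\<Lambda> > 0" "A > 0" "t \<ge> 0"
  shows "Psi_fun m c A \<Lambda> D \<epsilon> t \<ge> 0"
  using strict_mono_on_leD[OF strict_mono_on_Psi_fun[OF assms(1-5)], of 0 t m] Psi_fun_zero[OF assms(1)] assms(6)
  by simp

text \<open>By \<open>vol\<close> the coefficient of the linear term is at least \<open>A\<close>,
  and the other summands are nonnegative. This serves the regime where \<open>t\<close> is not
  small.\<close>

lemma Psi_fun_ge_linear:
  assumes "\<epsilon> > 0" "D \<ge> 0" "c > 0" "\<Lambda> > 0" "A > 0" "t \<ge> 0"
    and vol: "psi_vol \<Lambda> D \<epsilon> \<le> c * (unit_ball_vol (real m) * \<epsilon> ^ m)"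
  shows "A * t \<le> Psi_fun m c A \<Lambda> D \<epsilon> t"
proof -
  note \<psi> = psi_vol_bounds[OF assms(1,2), of \<Lambda>]
  have "1 \<le> \<epsilon> ^ m * unit_ball_vol (real m) * c / psi_vol \<Lambda> D \<epsilon>"
    using vol \<psi> by (simp add: mult_ac)
  then have "1 * (A * t) \<le> \<epsilon> ^ m * unit_ball_vol (real m) * c / psi_vol \<Lambda> D \<epsilon> * (A * t)"
    using assms by (intro mult_right_mono) auto
  then have "A * t \<le> \<epsilon> ^ m * unit_ball_vol (real m) * c * A / psi_vol \<Lambda> D \<epsilon> * t"
    by (simp add: mult_ac)
  moreover have "0 \<le> \<epsilon>\<^sup>2 / (psi_vol \<Lambda> D \<epsilon>)\<^sup>2 * (growth \<Lambda> \<epsilon> (sqrt t) + sqrt t)"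
    using assms \<psi> by (intro mult_nonneg_nonneg add_nonneg_nonneg growth_nonneg) auto
  moreover have "0 \<le> 2 * \<epsilon> * (1 + 2 * \<epsilon>) * (sqrt t / psi_vol \<Lambda> D \<epsilon> + growth \<Lambda> \<epsilon> (sqrt t))"
    using assms \<psi> by (intro mult_nonneg_nonneg add_nonneg_nonneg growth_nonneg) auto
  ultimately show ?thesis unfolding Psi_fun_eq by linarith
qed

text \<open>Trades a factor \<open>k\<close> for the passage from \<open>s\<^sup>2\<close> to
  \<open>s\<close>: the \<open>k\<close>-th power of \<open>1 + s\<^sup>2 / \<epsilon>\<close> is at
  most \<open>1 + s / \<epsilon>\<close>, and after raising to the power \<open>\<Lambda>\<close>
  Bernoulli's inequality extracts \<open>k\<close>. The conditions on \<open>s\<close> do not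
  involve \<open>\<Lambda>\<close>, so the threshold derived from them depends on
  \<open>\<epsilon>\<close> and \<open>k\<close> alone.\<close>

lemma growth_multiple_le:
  fixes k :: nat
  assumes "\<epsilon> > 0" "\<Lambda> > 0" "s \<ge> 0" "s \<le> 2 * \<epsilon>" "2 * real k * s \<le> 1"
  shows "real k * growth \<Lambda> \<epsilon> (s\<^sup>2) \<le> growth \<Lambda> \<epsilon> s"
proof -
  define u where "u = (1 + s\<^sup>2 / \<epsilon>) powr \<Lambda>"
  define y where "y = real k * (s\<^sup>2 / \<epsilon>)"
  have y: "0 \<le> y" using assms by (simp add: y_def)
  define w where "w = s / \<epsilon>"
  have w: "0 \<le> w" "w \<le> 2" using assms by (auto simp: w_def divide_le_eq)
  have "y = (real k * s) * w" by (simp add: y_def w_def power2_eq_square)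
  also have "\<dots> \<le> (1 / 2) * w"
    using assms w by (intro mult_right_mono) auto
  finally have y2: "2 * y \<le> w" by simp
  \<comment> \<open>This is what \<open>s \<le> 2 * \<epsilon>\<close> is for: on
    \<open>[0, 1]\<close> the exponential is at most \<open>1 + y + y\<^sup>2\<close>, hence at most
    \<open>1 + 2 * y\<close>.\<close>
  with w have "y \<le> 1" by linarith
  have "(1 + s\<^sup>2 / \<epsilon>) ^ k \<le> exp (s\<^sup>2 / \<epsilon>) ^ k"
    using assms by (intro power_mono exp_ge_add_one_self) auto
  also have "\<dots> = exp y" unfolding y_def exp_of_nat_mult ..
  also have "\<dots> \<le> 1 + y + y\<^sup>2" using exp_bound[of y] y \<open>y \<le> 1\<close> by simp
  also have "\<dots> \<le> 1 + 2 * y"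
    using mult_left_le_one_le[of y y] y \<open>y \<le> 1\<close> by (simp add: power2_eq_square)
  also have "\<dots> \<le> 1 + s / \<epsilon>" using y2 by (simp add: w_def)
  finally have "(1 + s\<^sup>2 / \<epsilon>) ^ k \<le> 1 + s / \<epsilon>" .
  then have "((1 + s\<^sup>2 / \<epsilon>) ^ k) powr \<Lambda> \<le> (1 + s / \<epsilon>) powr \<Lambda>"
    using assms by (intro powr_mono2) auto
  moreover have "((1 + s\<^sup>2 / \<epsilon>) ^ k) powr \<Lambda> = u ^ k"
  proof -
    have "1 + s\<^sup>2 / \<epsilon> > 0" using assms by (simp add: add_pos_nonneg)
    then show ?thesis
      by (simp add: u_def powr_realpow[symmetric] powr_powr powr_gt_zero mult.commute)
  qed
  moreover have "u \<ge> 1" using assms by (simp add: u_def ge_one_powr_ge_zero)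
  then have "1 + real k * (u - 1) \<le> u ^ k" using Bernoulli_inequality[of "u - 1" k] by simp
  ultimately show ?thesis by (simp add: growth_def u_def)
qed

text \<open>Both terms fit into the last summand of \<open>Psi_fun\<close>, which is at least
  \<open>2 * \<epsilon> * (sqrt t + growth \<Lambda> \<epsilon> (sqrt t))\<close>. Since
  \<open>k \<ge> 1\<close> gives \<open>2 * t \<le> sqrt t\<close>, the first term is covered;
  \<open>9 * \<epsilon> \<le> 2 * real k\<close> lets \<open>growth_multiple_le\<close> cover the
  second.\<close>

lemma Psi_fun_ge_small:
  fixes k :: nat
  assumes "\<epsilon> > 0" "D \<ge> 0" "c > 0" "\<Lambda> > 0" "A > 0" "t \<ge> 0"
    and k: "1 \<le> k" "9 * \<epsilon> \<le> 2 * real k"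
    and t: "sqrt t \<le> 2 * \<epsilon>" "2 * real k * sqrt t \<le> 1"
  shows "4 * \<epsilon> * t + 9 * \<epsilon>\<^sup>2 * growth \<Lambda> \<epsilon> t \<le> Psi_fun m c A \<Lambda> D \<epsilon> t"
proof -
  note \<psi> = psi_vol_bounds[OF assms(1,2), of \<Lambda>]
  have g: "0 \<le> growth \<Lambda> \<epsilon> t" "0 \<le> growth \<Lambda> \<epsilon> (sqrt t)"
    using assms by (auto intro!: growth_nonneg)
  have "2 * sqrt t \<le> 2 * real k * sqrt t" using k assms by (simp add: mult_right_mono mult_le_cancel_right1)
  with t have "2 * sqrt t \<le> 1" by linarith
  then have "(2 * sqrt t) * sqrt t \<le> 1 * sqrt t" using assms by (intro mult_right_mono) auto
  then have "2 * t \<le> sqrt t" using assms by (simp add: mult.assoc)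
  then have 1: "4 * \<epsilon> * t \<le> 2 * \<epsilon> * sqrt t" using assms by simp
  have "real k * growth \<Lambda> \<epsilon> t \<le> growth \<Lambda> \<epsilon> (sqrt t)"
    using growth_multiple_le[of \<epsilon> \<Lambda> "sqrt t" k] assms by simp
  moreover have "9 * \<epsilon> * growth \<Lambda> \<epsilon> t \<le> 2 * real k * growth \<Lambda> \<epsilon> t"
    using k g by (intro mult_right_mono)
  ultimately have "9 * \<epsilon> * growth \<Lambda> \<epsilon> t \<le> 2 * growth \<Lambda> \<epsilon> (sqrt t)" by linarith
  then have "\<epsilon> * (9 * \<epsilon> * growth \<Lambda> \<epsilon> t) \<le> \<epsilon> * (2 * growth \<Lambda> \<epsilon> (sqrt t))"
    using assms by simp
  then have 2: "9 * \<epsilon>\<^sup>2 * growth \<Lambda> \<epsilon> t \<le> 2 * \<epsilon> * growth \<Lambda> \<epsilon> (sqrt t)"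
    by (simp add: power2_eq_square mult_ac)
  have "sqrt t \<le> sqrt t / psi_vol \<Lambda> D \<epsilon>"
    using \<psi> assms by (simp add: le_divide_eq mult_left_le)
  then have "2 * \<epsilon> * 1 * (sqrt t + growth \<Lambda> \<epsilon> (sqrt t))
      \<le> 2 * \<epsilon> * (1 + 2 * \<epsilon>) * (sqrt t / psi_vol \<Lambda> D \<epsilon> + growth \<Lambda> \<epsilon> (sqrt t))"
    using assms g by (intro mult_mono add_mono) auto
  moreover have "0 \<le> \<epsilon> ^ m * unit_ball_vol (real m) * c * A / psi_vol \<Lambda> D \<epsilon> * t"
    using assms \<psi> by simp
  moreover have "0 \<le> \<epsilon>\<^sup>2 / (psi_vol \<Lambda> D \<epsilon>)\<^sup>2 * (growth \<Lambda> \<epsilon> (sqrt t) + sqrt t)"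
    using assms g by simp
  ultimately show ?thesis
    using 1 2 unfolding Psi_fun_eq by (simp add: distrib_left)
qed

section \<open>Comparison of local covariances along a coupling\<close>

lemma metric_ball_mono: "r \<le> s \<Longrightarrow> metric_ball X x r \<subseteq> metric_ball X x s"
  by (auto simp: metric_ball_def)

lemma measure_metric_ball_growth:
  assumes \<alpha>: "\<alpha> \<in> regular_prob_measures c \<Lambda> X" and "x \<in> X" "\<epsilon> > 0" "s \<ge> 0"
  shows "measure \<alpha> (metric_ball X x (\<epsilon> + s)) \<le> (1 + growth \<Lambda> \<epsilon> s) * measure \<alpha> (metric_ball X x \<epsilon>)"
proof -
  have "\<alpha> \<in> full_prob_measures X" using \<alpha> by (simp add: regular_prob_measures_def)
  from measure_metric_ball_pos[OF this assms(2,3)]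
  have pos: "measure \<alpha> (metric_ball X x \<epsilon>) > 0" .
  have "measure \<alpha> (metric_ball X x (\<epsilon> + s)) / measure \<alpha> (metric_ball X x \<epsilon>)
      \<le> ((\<epsilon> + s) / \<epsilon>) powr \<Lambda>"
    using assms unfolding regular_prob_measures_def by auto
  moreover have "(\<epsilon> + s) / \<epsilon> = 1 + s / \<epsilon>" using assms by (simp add: add_divide_distrib)
  ultimately show ?thesis using pos by (simp add: growth_def divide_le_eq)
qed

text \<open>A ball of radius \<open>D\<close> is all of \<open>X\<close> and has mass 1; if
  \<open>\<epsilon> < D\<close>, the doubling condition between the radii \<open>D\<close> and
  \<open>\<epsilon>\<close> bounds the smaller ball from below.\<close>

lemma psi_vol_le_measure_metric_ball:
  assumes \<alpha>: "\<alpha> \<in> regular_prob_measures c \<Lambda> X" and "compact X" "diameter X \<le> D" "x \<in> X"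
    and "\<epsilon> > 0" "D \<ge> 0"
  shows "psi_vol \<Lambda> D \<epsilon> \<le> measure \<alpha> (metric_ball X x \<epsilon>)"
proof -
  have \<alpha>': "\<alpha> \<in> full_prob_measures X" using \<alpha> by (simp add: regular_prob_measures_def)
  note \<alpha>D = full_prob_measuresD[OF \<alpha>']
  interpret prob_space \<alpha> by fact
  have dist_le: "dist x y \<le> D" if "y \<in> X" for y
    using diameter_bounded_bound[OF compact_imp_bounded[OF \<open>compact X\<close>] \<open>x \<in> X\<close> that] assms by simp
  have ball: "metric_ball X x r = X" if "D \<le> r" for r
    using dist_le that by (force simp: metric_ball_def)
  have full: "measure \<alpha> (metric_ball X x r) = 1" if "D \<le> r" for r
    using ball[OF that] prob_space \<alpha>D(2) by simp
  show ?thesis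
  proof (cases "D \<le> \<epsilon>")
    case True
    then show ?thesis using full[OF True] by (auto simp: psi_vol_def)
  next
    case False
    have pos: "measure \<alpha> (metric_ball X x \<epsilon>) > 0"
      by (rule measure_metric_ball_pos) (use \<alpha>' assms in auto)
    have "measure \<alpha> (metric_ball X x D) / measure \<alpha> (metric_ball X x \<epsilon>) \<le> (D / \<epsilon>) powr \<Lambda>"
      using assms False unfolding regular_prob_measures_def by auto
    then have "1 \<le> (D / \<epsilon>) powr \<Lambda> * measure \<alpha> (metric_ball X x \<epsilon>)"
      using full[of D] pos by (simp add: divide_le_eq)
    then have "(\<epsilon> / D) powr \<Lambda> * 1
        \<le> (\<epsilon> / D) powr \<Lambda> * ((D / \<epsilon>) powr \<Lambda> * measure \<alpha> (metric_ball X x \<epsilon>))"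
      by (intro mult_left_mono) auto
    also have "\<dots> = measure \<alpha> (metric_ball X x \<epsilon>)"
      using False assms by (simp add: mult.assoc[symmetric] powr_mult[symmetric])
    finally show ?thesis using False assms by (auto simp: psi_vol_def min_le_iff_disj)
  qed
qed

text \<open>The mass of a single ball lies between \<open>psi_vol\<close> and \<open>c\<close> times
  its Lebesgue volume, so \<open>c\<close> cannot be too small. This supplies the assumption
  \<open>vol\<close> of \<open>Psi_fun_ge_linear\<close>.\<close>

lemma psi_vol_le_density_bound:
  fixes X :: "'a::euclidean_space set"
  assumes \<alpha>: "\<alpha> \<in> regular_prob_measures c \<Lambda> X" and "compact X" "diameter X \<le> D" "x \<in> X"
    and "\<epsilon> > 0" "D \<ge> 0" "c > 0"
  shows "psi_vol \<Lambda> D \<epsilon> \<le> c * (unit_ball_vol (real DIM('a)) * \<epsilon> ^ DIM('a))"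
proof -
  have \<alpha>': "\<alpha> \<in> full_prob_measures X" using \<alpha> by (simp add: regular_prob_measures_def)
  interpret prob_space \<alpha> using full_prob_measuresD[OF \<alpha>'] by simp
  have "metric_ball X x \<epsilon> = cball x \<epsilon> \<inter> X" by (auto simp: metric_ball_def)
  then have "emeasure \<alpha> (metric_ball X x \<epsilon>) \<le> ennreal c * emeasure lborel (cball x \<epsilon>)"
    using \<alpha> unfolding regular_prob_measures_def by auto
  also have "\<dots> = ennreal (c * (unit_ball_vol (real DIM('a)) * \<epsilon> ^ DIM('a)))"
    using assms by (simp add: emeasure_cball ennreal_mult'[symmetric])
  finally have "measure \<alpha> (metric_ball X x \<epsilon>) \<le> c * (unit_ball_vol (real DIM('a)) * \<epsilon> ^ DIM('a))"
    using assms by (simp add: emeasure_eq_measure)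
  with psi_vol_le_measure_metric_ball[OF assms(1-6)] show ?thesis by simp
qed

text \<open>Stated for two random variables on a common space so that the roles of \<open>\<alpha>\<close> and \<open>\<beta>\<close> can be
  exchanged, which removes the assumption \<open>b \<le> a\<close>.\<close>

lemma coupled_local_expectation_le:
  fixes g :: "'a::metric_space \<Rightarrow> real"
  assumes \<pi>: "prob_space \<pi>"
    and Y: "Y \<in> measurable \<pi> \<alpha>" "distr \<pi> \<alpha> Y = \<alpha>" and Z: "Z \<in> measurable \<pi> \<beta>" "distr \<pi> \<beta> Z = \<beta>"
    and sets: "sets \<alpha> = sets (restrict_space borel X)" "sets \<beta> = sets (restrict_space borel X)"
    and close: "AE p in \<pi>. dist (Y p) (Z p) \<le> s"
    and a: "a = measure \<alpha> (metric_ball X x \<epsilon>)" and b: "b = measure \<beta> (metric_ball X x \<epsilon>)"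
    and b_pos: "0 < b" and ba: "b \<le> a"
    and growth_a: "measure \<alpha> (metric_ball X x (\<epsilon> + s)) \<le> (1 + \<theta>) * a"
    and growth_b: "measure \<beta> (metric_ball X x (\<epsilon> + s)) \<le> (1 + \<theta>) * b"
    and pos: "s \<ge> 0" "L \<ge> 0" "\<theta> \<ge> 0"
    and g: "g \<in> borel_measurable borel"
    and g_bound: "\<And>y. y \<in> metric_ball X x \<epsilon> \<Longrightarrow> \<bar>g y\<bar> \<le> G"
    and g_lip: "\<And>y z. y \<in> metric_ball X x \<epsilon> \<Longrightarrow> z \<in> metric_ball X x \<epsilon> \<Longrightarrow> \<bar>g y - g z\<bar> \<le> L * dist y z"
  shows "\<bar>(LINT y|uniform_measure \<alpha> (metric_ball X x \<epsilon>). g y) - (LINT y|uniform_measure \<beta> (metric_ball X x \<epsilon>). g y)\<bar>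
    \<le> L * s + 3 * G * \<theta>"
proof -
  interpret prob_space \<pi> by fact
  define B where "B = metric_ball X x \<epsilon>"
  define C where "C = metric_ball X x (\<epsilon> + s)"
  have BC: "B \<subseteq> C" unfolding B_def C_def using pos by (intro metric_ball_mono) simp
  have m\<alpha>: "B \<in> sets \<alpha>" "C \<in> sets \<alpha>" and m\<beta>: "B \<in> sets \<beta>" "C \<in> sets \<beta>"
    using sets by (auto simp: B_def C_def metric_ball_measurable)
  have g\<alpha>: "g \<in> borel_measurable \<alpha>" and g\<beta>: "g \<in> borel_measurable \<beta>"
    using g by (auto simp: measurable_cong_sets[OF sets(1) refl] measurable_cong_sets[OF sets(2) refl]
        intro: measurable_restrict_space1)
  have sp: "space \<alpha> = X" "space \<beta> = X"
    using sets_eq_imp_space_eq[OF sets(1)] sets_eq_imp_space_eq[OF sets(2)]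
    by (simp_all add: space_restrict_space)
  have YX: "Y p \<in> X" "Z p \<in> X" if "p \<in> space \<pi>" for p
    using measurable_space[OF Y(1) that] measurable_space[OF Z(1) that] sp by auto
  interpret Bt: prob_space \<beta> by (metis Z prob_space_distr)
  \<comment> \<open>A point of the ball is needed to read off \<open>G \<ge> 0\<close> from the
    bound on \<open>g\<close>.\<close>
  have "B \<noteq> {}" using b b_pos by (auto simp: B_def)
  then have G: "G \<ge> 0" using g_bound B_def by fastforce
  have a_pos: "0 < a" using b_pos ba by simp
  have int\<alpha>: "(LINT p|\<pi>. f (Y p)) = (LINT y|\<alpha>. f y)" if "f \<in> borel_measurable \<alpha>" for f :: "'a \<Rightarrow> real"
    using integral_distr[OF Y(1) that] Y(2) by simp
  have int\<beta>: "(LINT p|\<pi>. f (Z p)) = (LINT y|\<beta>. f y)" if "f \<in> borel_measurable \<beta>" for f :: "'a \<Rightarrow> real"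
    using integral_distr[OF Z(1) that] Z(2) by simp
  have ig\<alpha>: "(\<lambda>y. indicator B y * g y) \<in> borel_measurable \<alpha>" and ig\<beta>: "(\<lambda>y. indicator B y * g y) \<in> borel_measurable \<beta>"
    using g\<alpha> g\<beta> m\<alpha> m\<beta> by auto
  have gB: "\<bar>indicator B y * g y\<bar> \<le> G * indicator B y" for y
    using g_bound G by (auto simp: indicator_def B_def)
  have gB': "\<bar>indicator B y * g y\<bar> \<le> G" for y
    using gB[of y] G by (auto simp: indicator_def split: if_splits)
  have int_ind: "integrable \<pi> (\<lambda>p. indicator S (Y p) :: real)" if "S \<in> sets \<alpha>" for S
    using that Y(1) by (intro integrable_const_bound[of _ 1]) (auto simp: indicator_def)
  have int_ind': "integrable \<pi> (\<lambda>p. indicator S (Z p) :: real)" if "S \<in> sets \<beta>" for S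
    using that Z(1) by (intro integrable_const_bound[of _ 1]) (auto simp: indicator_def)
  have int_gY: "integrable \<pi> (\<lambda>p. indicator B (Y p) * g (Y p))"
    using gB' measurable_compose[OF Y(1) ig\<alpha>] by (intro integrable_const_bound[of _ G]) auto
  have int_gZ: "integrable \<pi> (\<lambda>p. indicator B (Z p) * g (Z p))"
    using gB' measurable_compose[OF Z(1) ig\<beta>] by (intro integrable_const_bound[of _ G]) auto
  define I where "I = (LINT y|\<alpha>. indicator B y * g y)"
  define J where "J = (LINT y|\<beta>. indicator B y * g y)"
  have meas_ind: "(LINT p|\<pi>. indicator S (Y p)) = measure \<alpha> S" if "S \<in> sets \<alpha>" for S
    using int\<alpha>[of "indicator S"] that by simp
  have meas_ind': "(LINT p|\<pi>. indicator S (Z p)) = measure \<beta> S" if "S \<in> sets \<beta>" for S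
    using int\<beta>[of "indicator S"] that by simp
  \<comment> \<open>Transport by at most \<open>s\<close> can leave the ball \<open>B\<close> only
    for the enlarged ball \<open>C\<close>; integrating this over the coupling bounds
    \<open>a\<close> by \<open>(1 + \<theta>) * b\<close>.\<close>
  have move: "z \<in> C" if "y \<in> B" "z \<in> X" "dist y z \<le> s" for y z
    using that dist_triangle[of x z y] by (auto simp: B_def C_def metric_ball_def)
  have "a = (LINT p|\<pi>. indicator B (Y p))" using meas_ind[OF m\<alpha>(1)] by (simp add: a B_def)
  also have "\<dots> \<le> (LINT p|\<pi>. indicator C (Z p))"
  proof (intro integral_mono_AE int_ind int_ind' m\<alpha> m\<beta>)
    show "AE p in \<pi>. (indicator B (Y p) :: real) \<le> indicator C (Z p)"
      using close AE_space by eventually_elim (auto simp: indicator_def intro: move YX)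
  qed
  also have "\<dots> \<le> (1 + \<theta>) * b" using meas_ind'[OF m\<beta>(2)] growth_b by (simp add: C_def)
  finally have ab: "a \<le> (1 + \<theta>) * b" .
  have "\<bar>I - J\<bar> = \<bar>LINT p|\<pi>. indicator B (Y p) * g (Y p) - indicator B (Z p) * g (Z p)\<bar>"
    using int_gY int_gZ int\<alpha>[OF ig\<alpha>] int\<beta>[OF ig\<beta>] by (simp add: I_def J_def)
  \<comment> \<open>If both points lie in \<open>B\<close>, the Lipschitz bound applies. If exactly
    one does, the other lies in the shell \<open>C - B\<close>, and the difference is at most
    \<open>G\<close>.\<close>
  also have "\<dots> \<le> (LINT p|\<pi>. L * s * indicator B (Y p) + G * (indicator C (Y p) - indicator B (Y p))
      + G * (indicator C (Z p) - indicator B (Z p)))"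
  proof (rule order_trans[OF integral_abs_bound], rule integral_mono_AE)
    show "AE p in \<pi>. \<bar>indicator B (Y p) * g (Y p) - indicator B (Z p) * g (Z p)\<bar>
      \<le> L * s * indicator B (Y p) + G * (indicator C (Y p) - indicator B (Y p))
      + G * (indicator C (Z p) - indicator B (Z p))"
      using close AE_space
    proof eventually_elim
      case (elim p)
      have "Y p \<in> X" "Z p \<in> X" using YX elim by auto
      consider "Y p \<in> B" "Z p \<in> B" | "Y p \<in> B" "Z p \<notin> B" | "Y p \<notin> B" "Z p \<in> B" | "Y p \<notin> B" "Z p \<notin> B"
        by blast
      then show ?case
      proof cases
        case 1
        then have "\<bar>g (Y p) - g (Z p)\<bar> \<le> L * dist (Y p) (Z p)" using g_lip by (simp add: B_def)
        also have "\<dots> \<le> L * s" using elim pos by (intro mult_left_mono) auto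
        finally show ?thesis using 1 BC by (auto simp: indicator_def)
      next
        case 2
        then have "Z p \<in> C" using move[of "Y p" "Z p"] elim \<open>Z p \<in> X\<close> by auto
        moreover have "\<bar>g (Y p)\<bar> \<le> G" using g_bound 2 by (simp add: B_def)
        ultimately show ?thesis using 2 BC pos by (auto simp: indicator_def intro: add_increasing)
      next
        case 3
        then have "Y p \<in> C" using move[of "Z p" "Y p"] elim \<open>Y p \<in> X\<close> by (auto simp: dist_commute)
        moreover have "\<bar>g (Z p)\<bar> \<le> G" using g_bound 3 by (simp add: B_def)
        ultimately show ?thesis using 3 BC by (auto simp: indicator_def)
      next
        case 4
        then show ?thesis using G by (auto simp: indicator_def)
      qed
    qed
  qed (use int_gY int_gZ int_ind int_ind' m\<alpha> m\<beta> in auto)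
  also have "\<dots> = L * s * a + G * (measure \<alpha> C - a) + G * (measure \<beta> C - b)"
    using int_ind int_ind' m\<alpha> m\<beta> meas_ind meas_ind' by (simp add: a b B_def[symmetric])
  also have "\<dots> \<le> L * s * a + G * (\<theta> * a) + G * (\<theta> * a)"
  proof (intro add_mono mult_left_mono G order_refl)
    show "measure \<alpha> C - a \<le> \<theta> * a" using growth_a by (simp add: C_def algebra_simps)
    have "measure \<beta> C - b \<le> \<theta> * b" using growth_b by (simp add: C_def algebra_simps)
    \<comment> \<open>By \<open>b \<le> a\<close> both shells are measured against \<open>a\<close>,
      the mass by which the difference of integrals is later divided.\<close>
    also have "\<dots> \<le> \<theta> * a" using ba pos by (intro mult_left_mono) auto
    finally show "measure \<beta> C - b \<le> \<theta> * a" .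
  qed (use pos in auto)
  finally have IJ: "\<bar>I - J\<bar> \<le> (L * s + 2 * G * \<theta>) * a" by (simp add: algebra_simps)
  have "\<bar>J\<bar> \<le> (LINT y|\<beta>. G * indicator B y)"
    unfolding J_def
    using gB gB' ig\<beta> m\<beta> G
    by (intro order_trans[OF integral_abs_bound] integral_mono Bt.integrable_const_bound[of _ G])
      (auto simp: indicator_def)
  also have "\<dots> = G * b" using m\<beta> by (simp add: b B_def)
  finally have J: "\<bar>J\<bar> \<le> G * b" .
  \<comment> \<open>Separates the change of the unnormalised integral from the change of
    normalisation. The two shells contribute \<open>2 * G * \<theta>\<close> and the normalisation
    \<open>G * \<theta>\<close>, whence the constant 3.\<close>
  have "I / a - J / b = (I - J) / a + J / b * ((b - a) / a)"
    using a_pos b_pos by (simp add: field_simps)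
  then have "\<bar>I / a - J / b\<bar> \<le> \<bar>(I - J) / a\<bar> + \<bar>J / b * ((b - a) / a)\<bar>"
    using abs_triangle_ineq by metis
  also have "\<dots> = \<bar>I - J\<bar> / a + \<bar>J\<bar> / b * ((a - b) / a)"
    using a_pos b_pos ba by (simp add: abs_mult)
  also have "\<dots> \<le> (L * s + 2 * G * \<theta>) + G * \<theta>"
  proof (intro add_mono mult_mono)
    show "\<bar>I - J\<bar> / a \<le> L * s + 2 * G * \<theta>" using IJ a_pos by (simp add: divide_le_eq)
    show "\<bar>J\<bar> / b \<le> G" using J b_pos by (simp add: divide_le_eq)
    have "\<theta> * b \<le> \<theta> * a" using ba pos by (intro mult_left_mono) auto
    then show "(a - b) / a \<le> \<theta>" using ab a_pos by (simp add: divide_le_eq algebra_simps)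
  qed (use G a_pos ba pos in auto)
  finally have "\<bar>I / a - J / b\<bar> \<le> L * s + 3 * G * \<theta>" by simp
  moreover have "(LINT y|uniform_measure \<alpha> B. g y) = I / a"
    unfolding I_def a B_def[symmetric]
    using m\<alpha> g\<alpha> a a_pos by (intro integral_uniform_measure) (auto simp: B_def)
  moreover have "(LINT y|uniform_measure \<beta> B. g y) = J / b"
    unfolding J_def b B_def[symmetric]
    using m\<beta> g\<beta> b b_pos by (intro integral_uniform_measure) (auto simp: B_def)
  ultimately show ?thesis by (simp add: B_def)
qed

text \<open>Whichever measure gives the ball more mass takes the role of \<open>\<alpha>\<close> in
  the one-sided estimate; in the second case the two projections are exchanged.\<close>

lemma coupled_local_expectation:
  fixes g :: "'a::euclidean_space \<Rightarrow> real"
  assumes \<alpha>: "\<alpha> \<in> regular_prob_measures c \<Lambda> X" and \<beta>: "\<beta> \<in> regular_prob_measures c \<Lambda> X"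
    and \<pi>: "\<pi> \<in> couplings \<alpha> \<beta>" and close: "AE p in \<pi>. dist (fst p) (snd p) \<le> s"
    and pos: "x \<in> X" "\<epsilon> > 0" "s \<ge> 0" "L \<ge> 0" "\<Lambda> > 0"
    and g: "g \<in> borel_measurable borel"
    and g_bound: "\<And>y. dist x y \<le> \<epsilon> \<Longrightarrow> \<bar>g y\<bar> \<le> G"
    and g_lip: "\<And>y z. dist x y \<le> \<epsilon> \<Longrightarrow> dist x z \<le> \<epsilon> \<Longrightarrow> \<bar>g y - g z\<bar> \<le> L * dist y z"
  shows "\<bar>(LINT y|local_measure \<epsilon> \<alpha> x. g y) - (LINT y|local_measure \<epsilon> \<beta> x. g y)\<bar>
    \<le> L * s + 3 * G * growth \<Lambda> \<epsilon> s"
proof -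
  have full: "\<alpha> \<in> full_prob_measures X" "\<beta> \<in> full_prob_measures X"
    using \<alpha> \<beta> by (auto simp: regular_prob_measures_def)
  note sets = full[THEN sets_restrict_full_prob_measure]
  have "prob_space \<pi>" and \<pi>_sets: "sets \<pi> = sets (\<alpha> \<Otimes>\<^sub>M \<beta>)"
    and marg: "distr \<pi> \<alpha> fst = \<alpha>" "distr \<pi> \<beta> snd = \<beta>"
    using \<pi> by (auto simp: couplings_def)
  have meas: "fst \<in> measurable \<pi> \<alpha>" "snd \<in> measurable \<pi> \<beta>"
    by (simp_all add: measurable_cong_sets[OF \<pi>_sets refl])
  have g_bound': "\<bar>g y\<bar> \<le> G" if "y \<in> metric_ball X x \<epsilon>" for y
    using g_bound that by (simp add: metric_ball_def)
  have g_lip': "\<bar>g y - g z\<bar> \<le> L * dist y z" if "y \<in> metric_ball X x \<epsilon>" "z \<in> metric_ball X x \<epsilon>" for y z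
    using g_lip that by (simp add: metric_ball_def)
  have close': "AE p in \<pi>. dist (snd p) (fst p) \<le> s" using close by (simp add: dist_commute)
  have \<theta>: "0 \<le> growth \<Lambda> \<epsilon> s" using pos by (intro growth_nonneg) auto
  note growth = measure_metric_ball_growth[OF \<alpha> pos(1-3)] measure_metric_ball_growth[OF \<beta> pos(1-3)]
  note ball_pos = full[THEN measure_metric_ball_pos, OF pos(1,2)]
  show ?thesis
  proof (cases "measure \<beta> (metric_ball X x \<epsilon>) \<le> measure \<alpha> (metric_ball X x \<epsilon>)")
    case True
    from coupled_local_expectation_le[OF \<open>prob_space \<pi>\<close> meas(1) marg(1) meas(2) marg(2) sets close refl refl
        ball_pos(2) True growth(1,2) pos(3,4) \<theta> g g_bound' g_lip']
    show ?thesis by (simp add: local_measure_def full_prob_measuresD(2)[OF full(1)] full_prob_measuresD(2)[OF full(2)])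
  next
    case False
    then have "measure \<alpha> (metric_ball X x \<epsilon>) \<le> measure \<beta> (metric_ball X x \<epsilon>)" by simp
    from coupled_local_expectation_le[OF \<open>prob_space \<pi>\<close> meas(2) marg(2) meas(1) marg(1) sets(2,1) close' refl refl
        ball_pos(1) this growth(2,1) pos(3,4) \<theta> g g_bound' g_lip']
    show ?thesis
      by (simp add: local_measure_def full_prob_measuresD(2)[OF full(1)] full_prob_measuresD(2)[OF full(2)]
          abs_minus_commute)
  qed
qed

text \<open>Full support makes the normalisation legitimate, so the local measure is a probability
  measure concentrated on the ball around \<open>x\<close>; boundedness holds with
  \<open>norm x + \<epsilon>\<close>. Expanding about \<open>x\<close> gives \<open>\<alpha>\<close>
  and \<open>\<beta>\<close> the same integrands.\<close>

lemma
  fixes \<alpha> :: "(real^'n) measure"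
  assumes \<alpha>: "\<alpha> \<in> full_prob_measures X" and x: "x \<in> X" and \<epsilon>: "\<epsilon> > 0"
  shows pos_semidef_local_cov: "pos_semidef (local_cov \<epsilon> \<alpha> x)"
    and quadratic_form_local_cov: "v \<bullet> (local_cov \<epsilon> \<alpha> x *v v)
      = (LINT y|local_measure \<epsilon> \<alpha> x. (v \<bullet> (y - x))\<^sup>2) - (LINT y|local_measure \<epsilon> \<alpha> x. v \<bullet> (y - x))\<^sup>2"
    and local_measure_integral_bound: "\<And>f :: real^'n \<Rightarrow> real. continuous_on UNIV f \<Longrightarrow>
      (\<And>y. dist x y \<le> \<epsilon> \<Longrightarrow> \<bar>f y\<bar> \<le> K) \<Longrightarrow> \<bar>LINT y|local_measure \<epsilon> \<alpha> x. f y\<bar> \<le> K"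
proof -
  note \<alpha>D = full_prob_measuresD[OF \<alpha>]
  interpret \<alpha>: prob_space \<alpha> by fact
  have "measure \<alpha> (metric_ball X x \<epsilon>) > 0" using measure_metric_ball_pos[OF \<alpha> x \<epsilon>] .
  then have nz: "emeasure \<alpha> (metric_ball X x \<epsilon>) \<noteq> 0" "emeasure \<alpha> (metric_ball X x \<epsilon>) \<noteq> \<infinity>"
    by (auto simp: \<alpha>.emeasure_eq_measure)
  interpret M: prob_space "local_measure \<epsilon> \<alpha> x"
    unfolding local_measure_def \<alpha>D(2) using nz by (rule prob_space_uniform_measure)
  have id: "(\<lambda>y. y) \<in> borel_measurable (local_measure \<epsilon> \<alpha> x)"
    using \<alpha>D(3) by (simp add: local_measure_def measurable_cong_sets[OF sets_uniform_measure refl])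
  have ae: "AE y in local_measure \<epsilon> \<alpha> x. dist x y \<le> \<epsilon>"
    unfolding local_measure_def \<alpha>D(2)
    by (rule AE_uniform_measureI[OF metric_ball_measurable[OF sets_restrict_full_prob_measure[OF \<alpha>]]])
      (simp add: metric_ball_def)
  have "AE y in local_measure \<epsilon> \<alpha> x. norm y \<le> norm x + \<epsilon>"
    using ae
  proof eventually_elim
    case (elim y)
    then show ?case using norm_triangle_ineq2[of y x] by (simp add: dist_norm norm_minus_commute)
  qed
  note * = M.prob_space_axioms id this
  show "pos_semidef (local_cov \<epsilon> \<alpha> x)"
    unfolding local_cov_def using * by (rule pos_semidef_cov_matrix)
  show "v \<bullet> (local_cov \<epsilon> \<alpha> x *v v)
      = (LINT y|local_measure \<epsilon> \<alpha> x. (v \<bullet> (y - x))\<^sup>2) - (LINT y|local_measure \<epsilon> \<alpha> x. v \<bullet> (y - x))\<^sup>2"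
    unfolding local_cov_def using * by (rule quadratic_form_cov_matrix)
  fix f :: "real^'n \<Rightarrow> real" and K
  assume f: "continuous_on UNIV f" and K: "\<And>y. dist x y \<le> \<epsilon> \<Longrightarrow> \<bar>f y\<bar> \<le> K"
  have ae_f: "AE y in local_measure \<epsilon> \<alpha> x. \<bar>f y\<bar> \<le> K"
    using ae by eventually_elim (rule K)
  have f_meas: "f \<in> borel_measurable (local_measure \<epsilon> \<alpha> x)"
    using measurable_compose[OF id borel_measurable_continuous_onI[OF f]] .
  have f_int: "integrable (local_measure \<epsilon> \<alpha> x) f"
    by (rule M.integrable_const_bound[of f K]) (simp_all add: ae_f f_meas)
  have "\<bar>LINT y|local_measure \<epsilon> \<alpha> x. f y\<bar> \<le> (LINT y|local_measure \<epsilon> \<alpha> x. \<bar>f y\<bar>)"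
    by (rule integral_abs_bound)
  also have "\<dots> \<le> (LINT y|local_measure \<epsilon> \<alpha> x. K)"
    by (intro integral_mono_AE ae_f integrable_abs f_int M.integrable_const)
  finally show "\<bar>LINT y|local_measure \<epsilon> \<alpha> x. f y\<bar> \<le> K" by (simp add: M.prob_space)
qed

text \<open>On the ball, \<open>f\<close> is bounded by \<open>\<epsilon>\<close> and 1-Lipschitz,
  and its square is bounded by \<open>\<epsilon>\<^sup>2\<close> and
  \<open>2 * \<epsilon>\<close>-Lipschitz. With \<open>\<theta>\<close> the growth at
  \<open>s\<close>, second moments differ by at most
  \<open>2 * \<epsilon> * s + 3 * \<epsilon>\<^sup>2 * \<theta>\<close>, squared means by at most
  \<open>2 * \<epsilon> * (s + 3 * \<epsilon> * \<theta>)\<close>; the sum is the bound.\<close>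

lemma local_cov_diff_coupling:
  fixes \<alpha> \<beta> :: "(real^'n) measure"
  assumes \<alpha>: "\<alpha> \<in> regular_prob_measures c \<Lambda> X" and \<beta>: "\<beta> \<in> regular_prob_measures c \<Lambda> X"
    and \<pi>: "\<pi> \<in> couplings \<alpha> \<beta>" and close: "AE p in \<pi>. dist (fst p) (snd p) \<le> s"
    and pos: "x \<in> X" "\<epsilon> > 0" "s \<ge> 0" "\<Lambda> > 0" and v: "norm v = 1"
  shows "\<bar>v \<bullet> ((local_cov \<epsilon> \<alpha> x - local_cov \<epsilon> \<beta> x) *v v)\<bar>
    \<le> 4 * \<epsilon> * s + 9 * \<epsilon>\<^sup>2 * growth \<Lambda> \<epsilon> s"
proof -
  have full: "\<alpha> \<in> full_prob_measures X" "\<beta> \<in> full_prob_measures X"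
    using \<alpha> \<beta> by (auto simp: regular_prob_measures_def)
  define f where "f y = v \<bullet> (y - x)" for y
  have f_cont: "continuous_on UNIV f" "continuous_on UNIV (\<lambda>y. (f y)\<^sup>2)"
    unfolding f_def by (intro continuous_intros)+
  have f_bound: "\<bar>f y\<bar> \<le> \<epsilon>" if "dist x y \<le> \<epsilon>" for y
    using Cauchy_Schwarz_ineq2[of v "y - x"] v that by (simp add: f_def dist_norm norm_minus_commute)
  have f_lip: "\<bar>f y - f z\<bar> \<le> 1 * dist y z" for y z
    using Cauchy_Schwarz_ineq2[of v "y - z"] v by (simp add: f_def dist_norm inner_diff_right)
  have f2_bound: "\<bar>(f y)\<^sup>2\<bar> \<le> \<epsilon>\<^sup>2" if "dist x y \<le> \<epsilon>" for y
    using power_mono[OF f_bound[OF that], of 2] by simp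
  have f2_lip: "\<bar>(f y)\<^sup>2 - (f z)\<^sup>2\<bar> \<le> 2 * \<epsilon> * dist y z" if "dist x y \<le> \<epsilon>" "dist x z \<le> \<epsilon>" for y z
  proof -
    have "(f y)\<^sup>2 - (f z)\<^sup>2 = (f y + f z) * (f y - f z)" by (simp add: power2_eq_square algebra_simps)
    then have "\<bar>(f y)\<^sup>2 - (f z)\<^sup>2\<bar> = \<bar>f y + f z\<bar> * \<bar>f y - f z\<bar>" by (simp add: abs_mult)
    also have "\<dots> \<le> (2 * \<epsilon>) * dist y z"
      using f_bound[OF that(1)] f_bound[OF that(2)] f_lip[of y z] pos by (intro mult_mono) auto
    finally show ?thesis .
  qed
  define ma mb where "ma = (LINT y|local_measure \<epsilon> \<alpha> x. f y)" and "mb = (LINT y|local_measure \<epsilon> \<beta> x. f y)"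
  define sa sb where "sa = (LINT y|local_measure \<epsilon> \<alpha> x. (f y)\<^sup>2)" and "sb = (LINT y|local_measure \<epsilon> \<beta> x. (f y)\<^sup>2)"
  have m: "\<bar>ma - mb\<bar> \<le> s + 3 * \<epsilon> * growth \<Lambda> \<epsilon> s"
    unfolding ma_def mb_def
    using coupled_local_expectation[OF \<alpha> \<beta> \<pi> close pos(1-3) _ pos(4) borel_measurable_continuous_onI[OF f_cont(1)]
        f_bound f_lip] by simp
  have s: "\<bar>sa - sb\<bar> \<le> 2 * \<epsilon> * s + 3 * \<epsilon>\<^sup>2 * growth \<Lambda> \<epsilon> s"
    unfolding sa_def sb_def
    using coupled_local_expectation[OF \<alpha> \<beta> \<pi> close pos(1-3) _ pos(4) borel_measurable_continuous_onI[OF f_cont(2)]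
        f2_bound f2_lip] pos by simp
  have mab: "\<bar>ma\<bar> \<le> \<epsilon>" "\<bar>mb\<bar> \<le> \<epsilon>"
    unfolding ma_def mb_def
    by (rule local_measure_integral_bound[OF full(1) pos(1,2) f_cont(1) f_bound], assumption)
      (rule local_measure_integral_bound[OF full(2) pos(1,2) f_cont(1) f_bound], assumption)
  have "ma\<^sup>2 - mb\<^sup>2 = (ma + mb) * (ma - mb)" by (simp add: power2_eq_square algebra_simps)
  then have "\<bar>ma\<^sup>2 - mb\<^sup>2\<bar> = \<bar>ma + mb\<bar> * \<bar>ma - mb\<bar>" by (simp add: abs_mult)
  also have "\<dots> \<le> (2 * \<epsilon>) * (s + 3 * \<epsilon> * growth \<Lambda> \<epsilon> s)"
    using mab m pos by (intro mult_mono) auto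
  finally have m2: "\<bar>ma\<^sup>2 - mb\<^sup>2\<bar> \<le> 2 * \<epsilon> * s + 6 * \<epsilon>\<^sup>2 * growth \<Lambda> \<epsilon> s"
    by (simp add: algebra_simps power2_eq_square)
  have "v \<bullet> ((local_cov \<epsilon> \<alpha> x - local_cov \<epsilon> \<beta> x) *v v) = (sa - ma\<^sup>2) - (sb - mb\<^sup>2)"
    unfolding sa_def sb_def ma_def mb_def f_def
    by (simp add: matrix_vector_mult_diff_rdistrib inner_diff_right
        quadratic_form_local_cov[OF full(1) pos(1,2)] quadratic_form_local_cov[OF full(2) pos(1,2)])
  then show ?thesis using s m2 by linarith
qed

text \<open>A variance is at most the second moment about any point, here the centre of the
  ball.\<close>

lemma quadratic_form_local_cov_le:
  fixes \<alpha> :: "(real^'n) measure"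
  assumes "\<alpha> \<in> full_prob_measures X" "x \<in> X" "\<epsilon> > 0" "norm v = 1"
  shows "v \<bullet> (local_cov \<epsilon> \<alpha> x *v v) \<le> \<epsilon>\<^sup>2"
proof -
  have "\<bar>LINT y|local_measure \<epsilon> \<alpha> x. (v \<bullet> (y - x))\<^sup>2\<bar> \<le> \<epsilon>\<^sup>2"
  proof (rule local_measure_integral_bound[OF assms(1-3)])
    fix y assume "dist x y \<le> \<epsilon>"
    then have "\<bar>v \<bullet> (y - x)\<bar> \<le> \<epsilon>"
      using Cauchy_Schwarz_ineq2[of v "y - x"] assms(4) by (simp add: dist_norm norm_minus_commute)
    then show "\<bar>(v \<bullet> (y - x))\<^sup>2\<bar> \<le> \<epsilon>\<^sup>2" using power_mono[of "\<bar>v \<bullet> (y - x)\<bar>" \<epsilon> 2] by simp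
  qed (intro continuous_intros)
  moreover have "0 \<le> (LINT y|local_measure \<epsilon> \<alpha> x. v \<bullet> (y - x))\<^sup>2" by simp
  ultimately show ?thesis
    unfolding quadratic_form_local_cov[OF assms(1-3)] by linarith
qed

text \<open>The infimum and suprema are genuine: the product measure is a coupling, and distances
  are bounded by the diameter of \<open>X\<close>. As a coupling is concentrated on its support, its
  cost bounds the distance almost everywhere, and any \<open>s\<close> above the infimum exceeds the
  cost of some coupling.\<close>

lemma
  fixes \<alpha> \<beta> :: "'a::{metric_space,second_countable_topology} measure"
  assumes \<alpha>: "\<alpha> \<in> full_prob_measures X" and \<beta>: "\<beta> \<in> full_prob_measures X" and "compact X"
  shows wasserstein_inf_nonneg: "0 \<le> wasserstein_inf \<alpha> \<beta>"
    and wasserstein_inf_coupling: "wasserstein_inf \<alpha> \<beta> < s \<Longrightarrow>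
      \<exists>\<pi>\<in>couplings \<alpha> \<beta>. AE p in \<pi>. dist (fst p) (snd p) \<le> s"
proof -
  note \<alpha>D = full_prob_measuresD[OF \<alpha>] and \<beta>D = full_prob_measuresD[OF \<beta>]
  interpret \<alpha>: prob_space \<alpha> by fact
  interpret \<beta>: prob_space \<beta> by fact
  interpret P: pair_prob_space \<alpha> \<beta> ..
  define cost where "cost \<pi> = (SUP p\<in>measure_support \<pi>. dist (fst p) (snd p))" for \<pi> :: "('a \<times> 'a) measure"
  have "distr (\<alpha> \<Otimes>\<^sub>M \<beta>) \<beta> snd = \<beta>"
  proof (intro measure_eqI)
    fix A assume A: "A \<in> sets (distr (\<alpha> \<Otimes>\<^sub>M \<beta>) \<beta> snd)"
    then have "snd -` A \<inter> space (\<alpha> \<Otimes>\<^sub>M \<beta>) = space \<alpha> \<times> A"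
      using sets.sets_into_space[of A \<beta>] by (auto simp: space_pair_measure)
    with A show "emeasure (distr (\<alpha> \<Otimes>\<^sub>M \<beta>) \<beta> snd) A = emeasure \<beta> A"
      by (simp add: emeasure_distr \<beta>.emeasure_pair_measure_Times \<alpha>.emeasure_space_1)
  qed simp
  then have "\<alpha> \<Otimes>\<^sub>M \<beta> \<in> couplings \<alpha> \<beta>"
    unfolding couplings_def
    using P.prob_space_axioms \<beta>.distr_pair_fst[of \<alpha>] by auto
  then have ne: "couplings \<alpha> \<beta> \<noteq> {}" by blast
  have W: "wasserstein_inf \<alpha> \<beta> = (INF \<pi>\<in>couplings \<alpha> \<beta>. cost \<pi>)"
    by (simp add: wasserstein_inf_def cost_def)
  have cost: "0 \<le> cost \<pi> \<and> (AE p in \<pi>. dist (fst p) (snd p) \<le> cost \<pi>)" if \<pi>: "\<pi> \<in> couplings \<alpha> \<beta>" for \<pi>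
  proof -
    interpret \<pi>: prob_space \<pi> using \<pi> by (simp add: couplings_def)
    have \<pi>_sets: "sets \<pi> = sets (\<alpha> \<Otimes>\<^sub>M \<beta>)" using \<pi> by (simp add: couplings_def)
    have sp: "space \<pi> = X \<times> X"
      using sets_eq_imp_space_eq[OF \<pi>_sets] by (simp add: space_pair_measure \<alpha>D \<beta>D)
    \<comment> \<open>By second countability the Borel sets of the product are generated by
      rectangles, so the identity is Borel measurable and \<open>AE_in_measure_support\<close>
      applies.\<close>
    have "(\<lambda>p. (fst p, snd p)) \<in> measurable \<pi> (borel \<Otimes>\<^sub>M borel)"
      unfolding measurable_cong_sets[OF \<pi>_sets refl]
      by (intro measurable_Pair measurable_compose[OF measurable_fst \<alpha>D(3)]
          measurable_compose[OF measurable_snd \<beta>D(3)])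
    then have "(\<lambda>p. p) \<in> borel_measurable \<pi>" by (simp add: borel_prod)
    then have ae: "AE p in \<pi>. p \<in> measure_support \<pi>" by (rule AE_in_measure_support)
    have bdd: "bdd_above ((\<lambda>p. dist (fst p) (snd p)) ` measure_support \<pi>)"
    proof (rule bdd_aboveI2)
      fix p assume "p \<in> measure_support \<pi>"
      then have "fst p \<in> X" "snd p \<in> X" using sp by (auto simp: measure_support_def)
      then show "dist (fst p) (snd p) \<le> diameter X"
        using diameter_bounded_bound[OF compact_imp_bounded[OF \<open>compact X\<close>]] by blast
    qed
    have le: "dist (fst p) (snd p) \<le> cost \<pi>" if "p \<in> measure_support \<pi>" for p
      unfolding cost_def by (rule cSUP_upper[OF that bdd])
    have "measure_support \<pi> \<noteq> {}" using ae by auto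
    then obtain p where "p \<in> measure_support \<pi>" by blast
    from le[OF this] have "0 \<le> cost \<pi>" by (meson order_trans zero_le_dist)
    moreover have "AE p in \<pi>. dist (fst p) (snd p) \<le> cost \<pi>"
      using ae by eventually_elim (rule le)
    ultimately show ?thesis by blast
  qed
  show "0 \<le> wasserstein_inf \<alpha> \<beta>"
    unfolding W using ne cost by (intro cINF_greatest) auto
  assume "wasserstein_inf \<alpha> \<beta> < s"
  then obtain \<pi> where \<pi>: "\<pi> \<in> couplings \<alpha> \<beta>" "cost \<pi> < s"
    using cInf_lessD[of "cost ` couplings \<alpha> \<beta>" s] ne unfolding W by auto
  from cost[OF \<pi>(1)] have "AE p in \<pi>. dist (fst p) (snd p) \<le> cost \<pi>" by blast
  then have "AE p in \<pi>. dist (fst p) (snd p) \<le> s" by eventually_elim (use \<pi>(2) in linarith)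
  with \<pi>(1) show "\<exists>\<pi>\<in>couplings \<alpha> \<beta>. AE p in \<pi>. dist (fst p) (snd p) \<le> s" by blast
qed

text \<open>The coupling estimate holds for every \<open>s > \<delta>\<close>; its right side is
  continuous in \<open>s\<close>, so it passes to the limit as \<open>s\<close> decreases to
  \<open>\<delta>\<close>.\<close>

lemma local_cov_diff_wasserstein:
  fixes \<alpha> \<beta> :: "(real^'n) measure"
  assumes \<alpha>: "\<alpha> \<in> regular_prob_measures c \<Lambda> X" and \<beta>: "\<beta> \<in> regular_prob_measures c \<Lambda> X"
    and "compact X" and pos: "x \<in> X" "\<epsilon> > 0" "\<Lambda> > 0" and v: "norm v = 1"
  defines "\<delta> \<equiv> wasserstein_inf \<alpha> \<beta>"
  shows "\<bar>v \<bullet> ((local_cov \<epsilon> \<alpha> x - local_cov \<epsilon> \<beta> x) *v v)\<bar>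
    \<le> 4 * \<epsilon> * \<delta> + 9 * \<epsilon>\<^sup>2 * growth \<Lambda> \<epsilon> \<delta>"
proof (rule tendsto_lowerbound)
  have full: "\<alpha> \<in> full_prob_measures X" "\<beta> \<in> full_prob_measures X"
    using \<alpha> \<beta> by (auto simp: regular_prob_measures_def)
  have \<delta>: "0 \<le> \<delta>" unfolding \<delta>_def by (rule wasserstein_inf_nonneg[OF full \<open>compact X\<close>])
  then have "1 + \<delta> / \<epsilon> > 0" using pos by (simp add: add_pos_nonneg)
  then show "((\<lambda>s. 4 * \<epsilon> * s + 9 * \<epsilon>\<^sup>2 * growth \<Lambda> \<epsilon> s) \<longlongrightarrow>
      4 * \<epsilon> * \<delta> + 9 * \<epsilon>\<^sup>2 * growth \<Lambda> \<epsilon> \<delta>) (at_right \<delta>)"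
    unfolding growth_def using pos by (intro tendsto_intros) auto
  have "\<bar>v \<bullet> ((local_cov \<epsilon> \<alpha> x - local_cov \<epsilon> \<beta> x) *v v)\<bar> \<le> 4 * \<epsilon> * s + 9 * \<epsilon>\<^sup>2 * growth \<Lambda> \<epsilon> s"
    if "s > \<delta>" for s
  proof -
    obtain \<pi> where "\<pi> \<in> couplings \<alpha> \<beta>" "AE p in \<pi>. dist (fst p) (snd p) \<le> s"
      using wasserstein_inf_coupling[OF full \<open>compact X\<close>] \<open>s > \<delta>\<close> unfolding \<delta>_def by blast
    from local_cov_diff_coupling[OF \<alpha> \<beta> this pos(1,2) _ pos(3) v] that \<delta> show ?thesis by simp
  qed
  then show "\<forall>\<^sub>F s in at_right \<delta>. \<bar>v \<bullet> ((local_cov \<epsilon> \<alpha> x - local_cov \<epsilon> \<beta> x) *v v)\<bar>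
      \<le> 4 * \<epsilon> * s + 9 * \<epsilon>\<^sup>2 * growth \<Lambda> \<epsilon> s"
    by (auto simp: eventually_at_filter)
qed simp

section \<open>From covariances to the GT distance\<close>

lemma abs_sqrt_sum_squares_diff_le:
  fixes p d e :: real
  shows "\<bar>sqrt (p\<^sup>2 + d\<^sup>2) - sqrt (p\<^sup>2 + e\<^sup>2)\<bar> \<le> \<bar>d - e\<bar>"
  using real_sqrt_sum_squares_triangle_ineq[of p 0 d "e - d"]
    real_sqrt_sum_squares_triangle_ineq[of p 0 e "d - e"] by (simp add: abs_minus_commute abs_le_iff)

text \<open>Replacing \<open>S\<close> by \<open>T\<close> at each endpoint costs at most
  \<open>r\<close> by the triangle inequality, which produces the factor 2.\<close>

lemma GT_dist_diff_le:
  fixes \<alpha> \<beta> :: "(real^'n) measure"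
  assumes full: "\<alpha> \<in> full_prob_measures X" "\<beta> \<in> full_prob_measures X"
    and pos: "x \<in> X" "x' \<in> X" "\<epsilon> > 0" "lam \<ge> 0"
    and close: "\<And>z v. z \<in> X \<Longrightarrow> norm v = 1 \<Longrightarrow>
      \<bar>v \<bullet> ((local_cov \<epsilon> \<alpha> z - local_cov \<epsilon> \<beta> z) *v v)\<bar> \<le> \<kappa>"
  shows "\<bar>GT_dist \<epsilon> lam \<alpha> x x' - GT_dist \<epsilon> lam \<beta> x x'\<bar> \<le> 2 * sqrt (real CARD('n) * lam * \<kappa>)"
proof -
  define S T where "S z = local_cov \<epsilon> \<alpha> z" and "T z = local_cov \<epsilon> \<beta> z" for z
  define r where "r = sqrt (real CARD('n) * \<kappa>)"
  have psd: "pos_semidef (S z)" "pos_semidef (T z)" if "z \<in> X" for z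
    using pos_semidef_local_cov[OF full(1) that pos(3)] pos_semidef_local_cov[OF full(2) that pos(3)]
    by (simp_all add: S_def T_def)
  have r: "d_cov (S z) (T z) \<le> r" if "z \<in> X" for z
    unfolding r_def using d_cov_perturbation[OF psd[OF that], of \<kappa>] close[OF that] by (simp add: S_def T_def)
  have r': "d_cov (T z) (S z) \<le> r" if "z \<in> X" for z
    using r[OF that] d_cov_commute[OF psd[OF that]] by simp
  note psd' = psd[OF pos(1)] psd[OF pos(2)]
  have "d_cov (S x) (S x') \<le> d_cov (S x) (T x) + (d_cov (T x) (T x') + d_cov (T x') (S x'))"
    using d_cov_triangle[OF psd'(1,2,3)] d_cov_triangle[OF psd'(2,4,3)] by linarith
  moreover have "d_cov (T x) (T x') \<le> d_cov (T x) (S x) + (d_cov (S x) (S x') + d_cov (S x') (T x'))"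
    using d_cov_triangle[OF psd'(2,1,4)] d_cov_triangle[OF psd'(1,3,4)] by linarith
  ultimately have d: "\<bar>d_cov (S x) (S x') - d_cov (T x) (T x')\<bar> \<le> 2 * r"
    using r[OF pos(1)] r[OF pos(2)] r'[OF pos(1)] r'[OF pos(2)] by linarith
  \<comment> \<open>This exhibits the GT distance as the norm of a plane vector whose first
    coordinate is the same for both measures, so only the second coordinates are compared.\<close>
  have gt: "GT_dist \<epsilon> lam \<gamma> x x'
      = sqrt ((norm (x - x'))\<^sup>2 + (sqrt lam * d_cov (local_cov \<epsilon> \<gamma> x) (local_cov \<epsilon> \<gamma> x'))\<^sup>2)" for \<gamma>
    using pos by (simp add: GT_dist_def power_mult_distrib)
  have "\<bar>GT_dist \<epsilon> lam \<alpha> x x' - GT_dist \<epsilon> lam \<beta> x x'\<bar>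
      \<le> \<bar>sqrt lam * d_cov (S x) (S x') - sqrt lam * d_cov (T x) (T x')\<bar>"
    unfolding gt S_def T_def by (rule abs_sqrt_sum_squares_diff_le)
  also have "\<dots> = sqrt lam * \<bar>d_cov (S x) (S x') - d_cov (T x) (T x')\<bar>"
    using pos by (simp add: right_diff_distrib[symmetric] abs_mult)
  also have "\<dots> \<le> sqrt lam * (2 * r)" using d pos by (intro mult_left_mono) auto
  also have "\<dots> = 2 * sqrt (real CARD('n) * lam * \<kappa>)"
    by (simp add: r_def real_sqrt_mult)
  finally show ?thesis .
qed

section \<open>Choice of \<open>A\<close> and the final estimate\<close>

theorem theorem3p1:
  fixes \<epsilon> D :: real
  assumes "\<epsilon> > 0" and "D \<ge> 0"
  shows "\<exists>A::real. A > 0 \<and>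
    (\<forall>c \<Lambda>::real. c > 0 \<and> \<Lambda> > 0 \<longrightarrow>
       Psi_fun CARD('n::finite) c A \<Lambda> D \<epsilon> \<in> {0..} \<rightarrow> {0..} \<and>
       strict_mono_on {0..} (Psi_fun CARD('n) c A \<Lambda> D \<epsilon>) \<and>
       Psi_fun CARD('n) c A \<Lambda> D \<epsilon> 0 = 0) \<and>
    (\<forall>(X :: (real^'n) set) (c::real) (\<Lambda>::real) (lam::real) \<alpha> \<beta>.
       compact X \<and> diameter X \<le> D \<and> c > 0 \<and> \<Lambda> > 0 \<and> lam \<ge> 0 \<and>
       \<alpha> \<in> regular_prob_measures c \<Lambda> X \<and> \<beta> \<in> regular_prob_measures c \<Lambda> X \<longrightarrow>
       (SUP (x, x') \<in> X \<times> X. ereal \<bar>GT_dist \<epsilon> lam \<alpha> x x' - GT_dist \<epsilon> lam \<beta> x x'\<bar>)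
         \<le> ereal (2 * sqrt (real CARD('n) * lam *
              Psi_fun CARD('n) c A \<Lambda> D \<epsilon> (wasserstein_inf \<alpha> \<beta>))))"
proof -
  \<comment> \<open>\<open>k\<close> must satisfy both conditions of
    \<open>Psi_fun_ge_small\<close>; adding 1 secures \<open>1 \<le> k\<close>. It is fixed from
    \<open>\<epsilon>\<close> before \<open>c\<close>, \<open>\<Lambda>\<close> and \<open>X\<close>
    appear.\<close>
  obtain k0 :: nat where "9 * \<epsilon> / 2 \<le> real k0" using real_arch_simple by blast
  define k where "k = k0 + 1"
  have k: "1 \<le> k" "9 * \<epsilon> \<le> 2 * real k" using \<open>9 * \<epsilon> / 2 \<le> real k0\<close> by (auto simp: k_def)
  \<comment> \<open>The threshold for \<open>sqrt \<delta>\<close> below which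
    \<open>Psi_fun_ge_small\<close> applies.\<close>
  define s0 where "s0 = min (2 * \<epsilon>) (1 / (2 * real k))"
  have s0: "0 < s0" using assms k by (simp add: s0_def)
  \<comment> \<open>Chosen so that \<open>A * \<delta>\<close> reaches the trivial bound
    \<open>\<epsilon>\<^sup>2\<close> as soon as \<open>sqrt \<delta>\<close> reaches
    \<open>s0\<close>.\<close>
  define A where "A = \<epsilon>\<^sup>2 / s0\<^sup>2"
  have A: "A > 0" using assms s0 by (simp add: A_def)
  show ?thesis
  proof (intro exI[of _ A] conjI allI impI A)
    fix c \<Lambda> :: real assume *: "c > 0 \<and> \<Lambda> > 0"
    then show "Psi_fun CARD('n) c A \<Lambda> D \<epsilon> \<in> {0..} \<rightarrow> {0..}"
      using Psi_fun_nonneg[OF assms _ _ A] by auto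
    show "strict_mono_on {0..} (Psi_fun CARD('n) c A \<Lambda> D \<epsilon>)"
      using * strict_mono_on_Psi_fun[OF assms _ _ A] by blast
    show "Psi_fun CARD('n) c A \<Lambda> D \<epsilon> 0 = 0" using Psi_fun_zero[OF assms(1)] .
  next
    fix X :: "(real^'n) set" and c \<Lambda> lam :: real and \<alpha> \<beta>
    assume *: "compact X \<and> diameter X \<le> D \<and> c > 0 \<and> \<Lambda> > 0 \<and> lam \<ge> 0 \<and>
       \<alpha> \<in> regular_prob_measures c \<Lambda> X \<and> \<beta> \<in> regular_prob_measures c \<Lambda> X"
    then have full: "\<alpha> \<in> full_prob_measures X" "\<beta> \<in> full_prob_measures X"
      by (auto simp: regular_prob_measures_def)
    define \<delta> where "\<delta> = wasserstein_inf \<alpha> \<beta>"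
    have \<delta>: "0 \<le> \<delta>" unfolding \<delta>_def using wasserstein_inf_nonneg[OF full] * by blast
    have close: "\<bar>v \<bullet> ((local_cov \<epsilon> \<alpha> z - local_cov \<epsilon> \<beta> z) *v v)\<bar> \<le> Psi_fun CARD('n) c A \<Lambda> D \<epsilon> \<delta>"
      if z: "z \<in> X" and v: "norm v = 1" for z v
    proof (cases "sqrt \<delta> \<le> s0")
      case True
      then have "2 * real k * sqrt \<delta> \<le> 2 * real k * (1 / (2 * real k))"
        by (intro mult_left_mono) (auto simp: s0_def)
      then have "2 * real k * sqrt \<delta> \<le> 1" using k by simp
      then have "4 * \<epsilon> * \<delta> + 9 * \<epsilon>\<^sup>2 * growth \<Lambda> \<epsilon> \<delta> \<le> Psi_fun CARD('n) c A \<Lambda> D \<epsilon> \<delta>"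
        using Psi_fun_ge_small[of \<epsilon> D c \<Lambda> A \<delta> k] assms * A \<delta> k True by (simp add: s0_def)
      moreover have "\<bar>v \<bullet> ((local_cov \<epsilon> \<alpha> z - local_cov \<epsilon> \<beta> z) *v v)\<bar>
          \<le> 4 * \<epsilon> * \<delta> + 9 * \<epsilon>\<^sup>2 * growth \<Lambda> \<epsilon> \<delta>"
        unfolding \<delta>_def using * assms(1) z v by (intro local_cov_diff_wasserstein[of _ c _ X]) auto
      ultimately show ?thesis by linarith
    next
      case False
      then have "s0\<^sup>2 \<le> (sqrt \<delta>)\<^sup>2" using s0 by (intro power_mono) auto
      then have "A * s0\<^sup>2 \<le> A * \<delta>" using A \<delta> by simp
      then have "\<epsilon>\<^sup>2 \<le> A * \<delta>" using s0 by (simp add: A_def)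
      also have "\<dots> \<le> Psi_fun CARD('n) c A \<Lambda> D \<epsilon> \<delta>"
        using psi_vol_le_density_bound[of \<alpha> c \<Lambda> X D z \<epsilon>] * assms z A \<delta>
        by (intro Psi_fun_ge_linear) auto
      finally have "\<epsilon>\<^sup>2 \<le> Psi_fun CARD('n) c A \<Lambda> D \<epsilon> \<delta>" .
      \<comment> \<open>Both forms lie in the same interval of length
        \<open>\<epsilon>\<^sup>2\<close>, so their difference is at most its length, independently
        of any coupling.\<close>
      moreover have "v \<bullet> (local_cov \<epsilon> \<gamma> z *v v) \<in> {0..\<epsilon>\<^sup>2}" if "\<gamma> \<in> full_prob_measures X" for \<gamma>
        using quadratic_form_local_cov_le[OF that z assms(1) v] pos_semidef_local_cov[OF that z assms(1)]
        by (simp add: pos_semidef_def)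
      from this[OF full(1)] this[OF full(2)]
      have "\<bar>v \<bullet> ((local_cov \<epsilon> \<alpha> z - local_cov \<epsilon> \<beta> z) *v v)\<bar> \<le> \<epsilon>\<^sup>2"
        by (simp add: matrix_vector_mult_diff_rdistrib inner_diff_right abs_le_iff)
      ultimately show ?thesis by linarith
    qed
    show "(SUP (x, x') \<in> X \<times> X. ereal \<bar>GT_dist \<epsilon> lam \<alpha> x x' - GT_dist \<epsilon> lam \<beta> x x'\<bar>)
         \<le> ereal (2 * sqrt (real CARD('n) * lam *
              Psi_fun CARD('n) c A \<Lambda> D \<epsilon> (wasserstein_inf \<alpha> \<beta>)))"
      unfolding \<delta>_def[symmetric]
    proof (rule SUP_least, clarify)
      fix x x' assume x: "x \<in> X" "x' \<in> X"
      have "\<bar>GT_dist \<epsilon> lam \<alpha> x x' - GT_dist \<epsilon> lam \<beta> x x'\<bar>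
        \<le> 2 * sqrt (real CARD('n) * lam * Psi_fun CARD('n) c A \<Lambda> D \<epsilon> \<delta>)"
        by (rule GT_dist_diff_le[OF full x assms(1) _ close]) (use * in blast)
      then show "ereal \<bar>GT_dist \<epsilon> lam \<alpha> x x' - GT_dist \<epsilon> lam \<beta> x x'\<bar>
        \<le> ereal (2 * sqrt (real CARD('n) * lam * Psi_fun CARD('n) c A \<Lambda> D \<epsilon> \<delta>))"
        by (simp only: ereal_less_eq)
    qed
  qed
qed

end
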